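(* Let $W$ be a connected graphon with degree function $k(x)=\int_0^1 W(x,y)\,dy$, and assume there is a constant $c$ with $0<c\le k(x)$ for all $x\in[0,1]$. Let $g\in L^2[0,1]$, and let $w(x,t)$ be the solution of the initial-value problem $$\frac{\partial}{\partial t}w(x,t)=\int_0^1\frac{W(x,y)}{k(y)}w(y,t)\,dy-w(x,t),\qquad w(x,0)=g(x).$$ For each $n\ge 1$ let $u(x,t)=u^{(n)}(x,t)$ be the solution of the initial-value problem on the quotient graph $W/\mathcal P$ with $n$ nodes, $$\frac{\partial}{\partial t}u(x,t)=\int_0^1\frac{\eta(W/\mathcal P)(x,y)}{k_\square(y)}u(y,t)\,dy-u(x,t),\qquad u(x,0)=g_\square(x).$$ Then for all $t\in\mathbb R^+$, $$\|u(\cdot,t)-w(\cdot,t)\|_{2}\to 0\quad\text{as } n\to\infty .$$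
   Context: A graphon is a symmetric Lebesgue-measurable function $W:[0,1]^2\to[0,1]$. It is connected if $\int_{S\times([0,1]\setminus S)}W(x,y)\,dx\,dy>0$ for every Lebesgue-measurable $S\subset[0,1]$ with Lebesgue measure $\mu(S)\in(0,1)$. Uniform partition: for $n\ge1$, $\mathcal P=\{P_1,\dots,P_n\}$ with $P_i=[\frac{i-1}{n},\frac in)$ for $i=1,\dots,n-1$ and $P_n=[\frac{n-1}{n},1]$. Quotient graph $W/\mathcal P$: the weighted graph on $n$ nodes with edge weights $A_{ij}=n^2\int_{P_i}\int_{P_j}W(x,y)\,dx\,dy$, $i,j=1,\dots,n$. Its step graphon is $\eta(W/\mathcal P)(x,y)=\sum_{i,j=1}^n A_{ij}\chi_{P_i}(x)\chi_{P_j}(y)$, and $k_\square(x)=\int_0^1\eta(W/\mathcal P)(x,y)\,dy$ is its degree function. The averaged initial condition is $g_\square(x)=n\sum_{i=1}^n\left(\int_{P_i}g(y)\,dy\right)\chi_{P_i}(x)$. Solutions are classical solutions of the abstract Cauchy problem in $L^2[0,1]$, i.e. $t\mapsto w(\cdot,t)\in L^2[0,1]$ is continuously differentiable and satisfies the equation and initial condition. $\|\cdot\|_2$ is the $L^2[0,1]$ norm. *)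

theory Defs
  imports "HOL-Analysis.Analysis"
begin

abbreviation unit_leb :: "real measure" where
  "unit_leb \<equiv> lebesgue_on {0..1}"

text \<open>
  Functions on the unit interval (or square) are total functions on the reals (or pairs of reals)
  of which only the values on the interval (or square) are used.
\<close>

definition graphon :: "(real \<Rightarrow> real \<Rightarrow> real) \<Rightarrow> bool" where
  "graphon W \<longleftrightarrow>
     (\<lambda>(x, y). W x y) \<in> borel_measurable (lebesgue_on ({0..1} \<times> {0..1})) \<and>
     (\<forall>x\<in>{0..1}. \<forall>y\<in>{0..1}. W x y = W y x \<and> 0 \<le> W x y \<and> W x y \<le> 1)"

definition connected_graphon :: "(real \<Rightarrow> real \<Rightarrow> real) \<Rightarrow> bool" where
  "connected_graphon W \<longleftrightarrow> graphon W \<and>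
     (\<forall>S. S \<subseteq> {0..1} \<longrightarrow> S \<in> sets lebesgue \<longrightarrow> measure lebesgue S \<in> {0<..<1} \<longrightarrow>
        (LINT (x, y)|lebesgue_on (S \<times> ({0..1} - S)). W x y) > 0)"

definition graphon_degree :: "(real \<Rightarrow> real \<Rightarrow> real) \<Rightarrow> real \<Rightarrow> real" where
  "graphon_degree W x = (LINT y|unit_leb. W x y)"

definition part :: "nat \<Rightarrow> nat \<Rightarrow> real set" where
  "part n i = (if i < n then {(real i - 1) / real n ..< real i / real n}
               else {(real i - 1) / real n .. 1})"

definition quotient_graph :: "nat \<Rightarrow> (real \<Rightarrow> real \<Rightarrow> real) \<Rightarrow> nat \<Rightarrow> nat \<Rightarrow> real" where
  "quotient_graph n W i j =
     (real n)\<^sup>2 * (LINT x|lebesgue_on (part n i). LINT y|lebesgue_on (part n j). W x y)"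

definition step_graphon :: "nat \<Rightarrow> (nat \<Rightarrow> nat \<Rightarrow> real) \<Rightarrow> real \<Rightarrow> real \<Rightarrow> real" where
  "step_graphon n A x y =
     (\<Sum>i=1..n. \<Sum>j=1..n. A i j * indicator (part n i) x * indicator (part n j) y)"

definition averaged :: "nat \<Rightarrow> (real \<Rightarrow> real) \<Rightarrow> real \<Rightarrow> real" where
  "averaged n g x =
     real n * (\<Sum>i=1..n. (LINT y|lebesgue_on (part n i). g y) * indicator (part n i) x)"

text \<open>
  The Hilbert space of square-integrable real functions on the unit interval is represented by
  representatives rather than classes: equality in it is equality almost everywhere.
\<close>

definition L2 :: "(real \<Rightarrow> real) set" where
  "L2 = {f. f \<in> borel_measurable unit_leb \<and> integrable unit_leb (\<lambda>x. (f x)\<^sup>2)}"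

definition L2_norm :: "(real \<Rightarrow> real) \<Rightarrow> real" where
  "L2_norm f = sqrt (LINT x|unit_leb. (f x)\<^sup>2)"

definition L2_continuous_on :: "real set \<Rightarrow> (real \<Rightarrow> real \<Rightarrow> real) \<Rightarrow> bool" where
  "L2_continuous_on T v \<longleftrightarrow>
     (\<forall>t\<in>T. ((\<lambda>s. L2_norm (\<lambda>x. v s x - v t x)) \<longlongrightarrow> 0) (at t within T))"

definition has_L2_derivative_within ::
  "(real \<Rightarrow> real \<Rightarrow> real) \<Rightarrow> (real \<Rightarrow> real) \<Rightarrow> real \<Rightarrow> real set \<Rightarrow> bool" where
  "has_L2_derivative_within v d t T \<longleftrightarrow>
     ((\<lambda>s. L2_norm (\<lambda>x. (v s x - v t x) / (s - t) - d x)) \<longlongrightarrow> 0) (at t within T)"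

text \<open>
  Classical solutions on \<open>[0, \<infinity>)\<close> of the initial-value problem governed by a kernel \<open>W\<close>, divided
  by its own degree function, with initial value \<open>g\<close>. Time is the first argument: \<open>v t x\<close> is the
  value at position \<open>x\<close> and time \<open>t\<close>. The derivative at time 0 is one-sided.
\<close>

definition classical_solution ::
  "(real \<Rightarrow> real \<Rightarrow> real) \<Rightarrow> (real \<Rightarrow> real) \<Rightarrow> (real \<Rightarrow> real \<Rightarrow> real) \<Rightarrow> bool" where
  "classical_solution W g v \<longleftrightarrow>
     (\<forall>t\<ge>0. v t \<in> L2) \<and>
     (AE x in unit_leb. v 0 x = g x) \<and>
     (\<exists>v'. (\<forall>t\<ge>0. v' t \<in> L2 \<and> has_L2_derivative_within v (v' t) t {0..}) \<and>
           L2_continuous_on {0..} v' \<and>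
           (\<forall>t\<ge>0. AE x in unit_leb.
              v' t x = (LINT y|unit_leb. W x y / graphon_degree W y * v t y) - v t x))"

end

theory Submission
  imports Defs
begin

text \<open>
  Write \<open>k\<close> for the degree function of \<open>W\<close>, and \<open>W\<^sub>n\<close>, \<open>k\<^sub>n\<close> for the step graphon of the quotient
  graph and its degree function. Both evolution equations are \<open>v' = K v - v\<close> for an integral
  operator \<open>K\<close> on \<open>L\<^sup>2\<close>, with kernel \<open>W(x,y)/k(y)\<close> and \<open>W\<^sub>n(x,y)/k\<^sub>n(y)\<close> respectively, so the theorem
  says that the solution depends continuously on the kernel and on the initial value.
  
  Everything with an index \<open>n\<close> is an average over the cells of a partition: \<open>W\<^sub>n\<close> is the cell average
  of \<open>W\<close> over the squares \<open>P\<^sub>i \<times> P\<^sub>j\<close>, and \<open>k\<^sub>n\<close> and the initial value are the cell averages of \<open>k\<close> and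
  \<open>g\<close> over the \<open>P\<^sub>i\<close> (\<open>step_graphon_eq_cell_average\<close>, \<open>degree_Wn\<close>, \<open>averaged_eq_cell_average\<close>). This
  has two consequences.
  
  The bounds \<open>0 \<le> W \<le> 1\<close> and \<open>c \<le> k\<close> pass to the averages, so the kernels are bounded by \<open>1/c\<close>
  uniformly in \<open>n\<close>, and so are the norms of the operators.
  
  Cell averages of a square integrable function converge to it in \<open>L\<^sup>2\<close> as the mesh tends to 0
  (\<open>cell_averages_converge\<close>): the mean is the best constant approximation on each cell, so the
  error is at most that of sampling a nearby continuous function at one point of each cell, and a
  continuous function on a compact set is uniformly continuous. Therefore \<open>W\<^sub>n \<longlonglongrightarrow> W\<close>, \<open>k\<^sub>n \<longlonglongrightarrow> k\<close> and
  \<open>g\<^sub>n \<longlonglongrightarrow> g\<close> in \<open>L\<^sup>2\<close>; as the denominators stay above \<open>c\<close>, the kernels converge in \<open>L\<^sup>2\<close> of the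
  square (\<open>kernel_distance\<close>), which controls the operators through the Hilbert-Schmidt norm.
  
  The error \<open>e = u - w\<close> satisfies \<open>e' = K\<^sub>n e - e + (K\<^sub>n - K) w\<close>. The derivative of the squared norm
  of \<open>e\<close> is \<open>2 \<langle>e', e\<rangle>\<close>, which is at most \<open>(2/c) \<parallel>e\<parallel>\<^sup>2 + \<parallel>(K\<^sub>n - K) w\<parallel>\<^sup>2\<close>, and Gronwall's argument
  (\<open>energy_estimate\<close>, \<open>classical_solution_stability\<close>) bounds \<open>\<parallel>e(t)\<parallel>\<^sup>2\<close> by a constant depending on
  \<open>t\<close> and \<open>c\<close> times the sum of \<open>\<parallel>g\<^sub>n - g\<parallel>\<^sup>2\<close> and a multiple of the squared \<open>L\<^sup>2\<close> distance of the
  kernels. Both tend to 0.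
\<close>

section \<open>Iterated integrals of Lebesgue measurable functions\<close>

text \<open>
  Lebesgue measure on a product is the completion of the product measure, so Fubini's theorem for
  product measures applies only after replacing \<open>f\<close> by a Borel function that agrees with it almost
  everywhere. For almost every \<open>x\<close> the sections of the two functions at \<open>x\<close> then agree almost
  everywhere, and only for such \<open>x\<close> is the section of \<open>f\<close> known to be measurable.
\<close>

lemma lebesgue_Fubini:
  fixes f :: "'a::euclidean_space \<times> 'b::euclidean_space \<Rightarrow> real"
  assumes A: "A \<in> sets borel" and B: "B \<in> sets borel"
    and f: "integrable (lebesgue_on (A \<times> B)) f"
  shows "AE x in lebesgue_on A. integrable (lebesgue_on B) (\<lambda>y. f (x, y))"
    and "integrable (lebesgue_on A) (\<lambda>x. LINT y|lebesgue_on B. f (x, y))"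
    and "(LINT x|lebesgue_on A. LINT y|lebesgue_on B. f (x, y)) = (LINT z|lebesgue_on (A \<times> B). f z)"
proof -
  have AB: "A \<times> B \<in> sets borel"
    using borel_Times[OF A B] .
  then have leb [measurable]: "A \<times> B \<in> sets lebesgue" "A \<in> sets lebesgue" "B \<in> sets lebesgue"
    using A B by auto
  define F where "F z = indicator (A \<times> B) z * f z" for z
  have F: "integrable lebesgue F"
    using f by (simp add: integrable_restrict_space F_def[abs_def])
  have "F \<in> borel_measurable lebesgue"
    using F by simp
  then obtain F' where F'm: "F' \<in> borel_measurable lborel" and F': "AE z in lborel. F z = F' z"
    using completion_ex_borel_measurable_real by blast
  have F'_leb: "F' \<in> borel_measurable lebesgue"
    using F'm by (rule measurable_completion)
  have F'c: "AE z in lebesgue. F z = F' z"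
    using F' by (rule AE_completion)
  have "integrable lebesgue F'"
    using integrable_cong_AE_imp[OF F F'_leb] F'c by auto
  then have F'i: "integrable (lborel \<Otimes>\<^sub>M lborel) F'"
    using F'm by (simp add: integrable_completion lborel_prod)
  have sec: "AE x in lborel. (AE y in lborel. F (x, y) = F' (x, y)) \<and> integrable lborel (\<lambda>y. F' (x, y))"
  proof -
    have "AE z in lborel \<Otimes>\<^sub>M lborel. F z = F' z"
      using F' by (simp only: lborel_prod)
    from lborel_pair.AE_pair[OF this] show ?thesis
      using lborel_pair.AE_integrable_fst'[OF F'i] by eventually_elim simp
  qed
  have F_sec: "F (x, y) = indicator A x * (indicator B y * f (x, y))" for x y
    by (simp add: F_def indicator_times)
  \<comment> \<open>On such a section completeness of Lebesgue measure transfers measurability from \<open>F'\<close> to \<open>F\<close>.\<close>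
  have key: "integrable lebesgue (\<lambda>y. F (x, y)) \<and>
      (LINT y|lebesgue. F (x, y)) = (LINT y|lborel. F' (x, y))"
    if "(AE y in lborel. F (x, y) = F' (x, y)) \<and> integrable lborel (\<lambda>y. F' (x, y))" for x
  proof -
    have i: "integrable lebesgue (\<lambda>y. F' (x, y))"
      using that by (subst integrable_completion) auto
    have ae: "AE y in lebesgue. F' (x, y) = F (x, y)"
      using AE_completion[OF conjunct1[OF that]] by (auto simp: eq_commute)
    have m: "(\<lambda>y. F (x, y)) \<in> borel_measurable lebesgue"
      using borel_measurable_AE[of "\<lambda>y. F' (x, y)" "\<lambda>y. F (x, y)"] i ae
      by (auto simp: lebesgue_on_UNIV_eq)
    have "integrable lebesgue (\<lambda>y. F (x, y))"
      using integrable_cong_AE_imp[OF i m] ae by auto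
    moreover have "(LINT y|lebesgue. F (x, y)) = (LINT y|lebesgue. F' (x, y))"
      using i m ae by (intro integral_cong_AE) auto
    moreover have "\<dots> = (LINT y|lborel. F' (x, y))"
      using that by (intro integral_completion) auto
    ultimately show ?thesis by simp
  qed
  have secc: "AE x in lebesgue. integrable lebesgue (\<lambda>y. F (x, y)) \<and>
      (LINT y|lborel. F' (x, y)) = (LINT y|lebesgue. F (x, y))"
    using AE_completion[OF sec] by eventually_elim (use key in auto)
  define G where "G x = (LINT y|lborel. F' (x, y))" for x
  have G: "integrable lborel G" "(LINT x|lborel. G x) = (LINT z|lebesgue. F' z)"
    using lborel_pair.integrable_fst'[OF F'i] lborel_pair.integral_fst'[OF F'i] integral_completion[OF F'm]
    unfolding G_def[abs_def] by (simp_all add: lborel_prod)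
  have Gc: "integrable lebesgue G"
    using G by (subst integrable_completion) auto
  have GF: "AE x in lebesgue. G x = (LINT y|lebesgue. F (x, y))"
    using secc by (auto simp: G_def)
  have m: "(\<lambda>x. LINT y|lebesgue. F (x, y)) \<in> borel_measurable lebesgue"
    using borel_measurable_AE[of G] Gc GF by (auto simp: lebesgue_on_UNIV_eq)
  have H: "integrable lebesgue (\<lambda>x. LINT y|lebesgue. F (x, y))"
    using integrable_cong_AE_imp[OF Gc m] GF by (auto simp: eq_commute)
  have Heq: "(LINT x|lebesgue. LINT y|lebesgue. F (x, y)) = (LINT z|lebesgue. F z)"
  proof -
    have "(LINT x|lebesgue. LINT y|lebesgue. F (x, y)) = (LINT x|lebesgue. G x)"
      using m Gc GF by (intro integral_cong_AE) (auto simp: eq_commute)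
    also have "\<dots> = (LINT z|lebesgue. F' z)"
      using G by (subst integral_completion) auto
    also have "\<dots> = (LINT z|lebesgue. F z)"
      using F F'_leb F'c by (intro integral_cong_AE) (auto simp: eq_commute)
    finally show ?thesis .
  qed
  have inner: "indicator A x * (LINT y|lebesgue_on B. f (x, y)) = (LINT y|lebesgue. F (x, y))" for x
    by (simp add: integral_restrict_space F_sec)
  show "AE x in lebesgue_on A. integrable (lebesgue_on B) (\<lambda>y. f (x, y))"
    using secc by (auto simp: AE_restrict_space_iff integrable_restrict_space F_sec elim!: eventually_mono)
  show "integrable (lebesgue_on A) (\<lambda>x. LINT y|lebesgue_on B. f (x, y))"
    using H by (simp add: integrable_restrict_space inner)
  show "(LINT x|lebesgue_on A. LINT y|lebesgue_on B. f (x, y)) = (LINT z|lebesgue_on (A \<times> B). f z)"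
    using Heq by (simp add: integral_restrict_space[of A] integral_restrict_space[of "A \<times> B"] inner F_def[abs_def])
qed

section \<open>Cell averages converge in \<open>L\<^sup>2\<close>\<close>

lemma square_sum_le: "(a + b)\<^sup>2 \<le> 2 * a\<^sup>2 + 2 * (b::real)\<^sup>2"
  using sum_squares_bound[of a b] by (simp add: power2_sum)

text \<open>
  A Lebesgue measurable function is an almost everywhere limit of continuous functions
  (\<open>measurable_on_iff_borel_measurable\<close>). To obtain convergence in \<open>L\<^sup>2\<close> by dominated convergence, the function is first
  truncated at a level \<open>m\<close>; the continuous approximants may then be truncated at the same level.
\<close>

lemma square_integrable_near_continuous:
  fixes f :: "'a::euclidean_space \<Rightarrow> real"
  assumes A: "A \<in> lmeasurable" and f: "f \<in> borel_measurable (lebesgue_on A)"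
    and f2: "integrable (lebesgue_on A) (\<lambda>x. (f x)\<^sup>2)" and e: "0 < e"
  obtains h where "continuous_on UNIV h" "bounded (range h)"
    "integrable (lebesgue_on A) (\<lambda>x. (f x - h x)\<^sup>2)"
    "(LINT x|lebesgue_on A. (f x - h x)\<^sup>2) < e"
proof -
  note [measurable] = f
  interpret finite_measure "lebesgue_on A"
    using A by (rule finite_measure_lebesgue_on)
  define tr where "tr m x = max (- real m) (min (real m) x)" for m x
  have tr_bd: "\<bar>tr m x\<bar> \<le> real m" for m x
    by (auto simp: tr_def)
  have tr_id: "tr m x = x" if "\<bar>x\<bar> \<le> real m" for m x
    using that by (auto simp: tr_def)
  have tr_m [measurable]: "tr m \<in> borel_measurable borel" for m
    unfolding tr_def[abs_def] by measurable
  have "(\<lambda>m. LINT x|lebesgue_on A. (f x - tr m (f x))\<^sup>2) \<longlonglongrightarrow> (LINT x|lebesgue_on A. 0)"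
  proof (rule integral_dominated_convergence[OF _ _ f2])
    show "AE x in lebesgue_on A. (\<lambda>m. (f x - tr m (f x))\<^sup>2) \<longlonglongrightarrow> 0"
    proof (intro AE_I2 tendsto_eventually)
      fix x
      obtain N where "\<bar>f x\<bar> \<le> real N"
        using real_arch_simple by blast
      then have "(f x - tr m (f x))\<^sup>2 = 0" if "N \<le> m" for m
        using that by (subst tr_id) auto
      then show "\<forall>\<^sub>F m in sequentially. (f x - tr m (f x))\<^sup>2 = 0"
        unfolding eventually_sequentially by blast
    qed
    show "AE x in lebesgue_on A. norm ((f x - tr m (f x))\<^sup>2) \<le> (f x)\<^sup>2" for m
      by (intro AE_I2) (auto simp: tr_def abs_le_square_iff[symmetric])
  qed auto
  then have "\<forall>\<^sub>F m in sequentially. (LINT x|lebesgue_on A. (f x - tr m (f x))\<^sup>2) < e / 4"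
    by (rule order_tendstoD) (use e in auto)
  then obtain m where m: "(LINT x|lebesgue_on A. (f x - tr m (f x))\<^sup>2) < e / 4"
    by (auto simp: eventually_sequentially)
  define F where "F x = tr m (f x)" for x
  have F [measurable]: "F \<in> borel_measurable (lebesgue_on A)"
    unfolding F_def[abs_def] by measurable
  then have "F measurable_on A"
    using A by (simp add: measurable_on_iff_borel_measurable)
  then obtain N h where N: "negligible N" and h: "\<And>n. continuous_on UNIV (h n)"
    and lim: "\<And>x. x \<notin> N \<Longrightarrow> (\<lambda>n. h n x) \<longlonglongrightarrow> (if x \<in> A then F x else 0)"
    unfolding measurable_on_def by blast
  have trh: "continuous_on UNIV (\<lambda>x. tr m (h n x))" for n
    unfolding tr_def by (intro continuous_intros h)
  have trh_m [measurable]: "(\<lambda>x. tr m (h n x)) \<in> borel_measurable (lebesgue_on A)" for n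
    using A by (intro continuous_imp_measurable_on_sets_lebesgue continuous_on_subset[OF trh]) auto
  have "AE x in lebesgue_on A. x \<notin> N"
  proof -
    have "AE x in lebesgue. x \<notin> N"
      using N by (intro AE_not_in) (simp add: negligible_iff_null_sets)
    then show ?thesis
      using A by (subst AE_restrict_space_iff) (auto elim: eventually_mono)
  qed
  then have lim': "AE x in lebesgue_on A. (\<lambda>n. (F x - tr m (h n x))\<^sup>2) \<longlonglongrightarrow> 0"
  proof (rule AE_mp, intro AE_I2 impI)
    fix x assume "x \<in> space (lebesgue_on A)" "x \<notin> N"
    then have "(\<lambda>n. h n x) \<longlonglongrightarrow> F x"
      using lim[of x] by simp
    then have "(\<lambda>n. (F x - tr m (h n x))\<^sup>2) \<longlonglongrightarrow> (F x - tr m (F x))\<^sup>2"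
      unfolding tr_def by (intro tendsto_intros)
    then show "(\<lambda>n. (F x - tr m (h n x))\<^sup>2) \<longlonglongrightarrow> 0"
      by (simp add: F_def tr_id[OF tr_bd])
  qed
  have bd: "(F x - tr m (h n x))\<^sup>2 \<le> (2 * real m)\<^sup>2" for n x
    using tr_bd[of m "f x"] tr_bd[of m "h n x"] unfolding F_def
    by (intro abs_le_square_iff[THEN iffD1]) auto
  have "(\<lambda>n. LINT x|lebesgue_on A. (F x - tr m (h n x))\<^sup>2) \<longlonglongrightarrow> (LINT x|lebesgue_on A. 0)"
    by (rule integral_dominated_convergence[where w="\<lambda>_. (2 * real m)\<^sup>2"]) (use bd lim' in auto)
  then have "\<forall>\<^sub>F n in sequentially. (LINT x|lebesgue_on A. (F x - tr m (h n x))\<^sup>2) < e / 4"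
    by (rule order_tendstoD) (use e in auto)
  then obtain n where n: "(LINT x|lebesgue_on A. (F x - tr m (h n x))\<^sup>2) < e / 4"
    by (auto simp: eventually_sequentially)
  have i1: "integrable (lebesgue_on A) (\<lambda>x. (f x - F x)\<^sup>2)"
    by (rule Bochner_Integration.integrable_bound[OF f2])
      (auto simp: F_def tr_def abs_le_square_iff[symmetric])
  have i2: "integrable (lebesgue_on A) (\<lambda>x. (F x - tr m (h n x))\<^sup>2)"
    by (rule integrable_const_bound[where B="(2 * real m)\<^sup>2"]) (use bd in auto)
  have le: "(f x - tr m (h n x))\<^sup>2 \<le> 2 * (f x - F x)\<^sup>2 + 2 * (F x - tr m (h n x))\<^sup>2" for x
    using square_sum_le[of "f x - F x" "F x - tr m (h n x)"] by simp
  have i3: "integrable (lebesgue_on A) (\<lambda>x. (f x - tr m (h n x))\<^sup>2)"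
    by (rule Bochner_Integration.integrable_bound[where f="\<lambda>x. 2 * (f x - F x)\<^sup>2 + 2 * (F x - tr m (h n x))\<^sup>2"])
      (use i1 i2 le in auto)
  have "(LINT x|lebesgue_on A. (f x - tr m (h n x))\<^sup>2)
      \<le> (LINT x|lebesgue_on A. 2 * (f x - F x)\<^sup>2 + 2 * (F x - tr m (h n x))\<^sup>2)"
    using i1 i2 i3 le by (intro integral_mono) auto
  also have "\<dots> < e"
    using i1 i2 m n by (simp add: F_def)
  finally show ?thesis
    using that[OF trh[of n] _ i3] tr_bd by (auto simp: bounded_iff)
qed

text \<open>
  The mesh is bounded by a strict inequality between distances of points, the form in which uniform
  continuity is applied. Cells may be empty or have measure zero; the average over a cell of
  measure zero is 0 by the convention on division.
\<close>

definition lebesgue_partition :: "'a::euclidean_space set \<Rightarrow> real \<Rightarrow> 'i set \<Rightarrow> ('i \<Rightarrow> 'a set) \<Rightarrow> bool" where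
  "lebesgue_partition A d I P \<longleftrightarrow>
     finite I \<and> (\<forall>i\<in>I. P i \<in> sets lebesgue) \<and> disjoint_family_on P I \<and> (\<Union>i\<in>I. P i) = A \<and>
     (\<forall>i\<in>I. \<forall>x\<in>P i. \<forall>y\<in>P i. dist x y < d)"

definition cell_average :: "'i set \<Rightarrow> ('i \<Rightarrow> 'a::euclidean_space set) \<Rightarrow> ('a \<Rightarrow> real) \<Rightarrow> 'a \<Rightarrow> real" where
  "cell_average I P f x =
     (\<Sum>i\<in>I. (LINT y|lebesgue_on (P i). f y) / measure lebesgue (P i) * indicator (P i) x)"

lemma sum_cells:
  fixes c :: "'i \<Rightarrow> real"
  assumes "finite I" "disjoint_family_on P I" "i \<in> I" "x \<in> P i"
  shows "(\<Sum>j\<in>I. c j * indicator (P j) x) = c i"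
proof -
  have "indicator (P j) x = (if j = i then 1 else (0::real))" if "j \<in> I" for j
    using that assms by (auto simp: disjoint_family_on_def indicator_def)
  then have "(\<Sum>j\<in>I. c j * indicator (P j) x) = (\<Sum>j\<in>I. if j = i then c j else 0)"
    by (intro sum.cong) auto
  then show ?thesis
    using assms by simp
qed

lemma cell_average_eq:
  assumes "lebesgue_partition A d I P" "i \<in> I" "x \<in> P i"
  shows "cell_average I P f x = (LINT y|lebesgue_on (P i). f y) / measure lebesgue (P i)"
  unfolding cell_average_def
  by (rule sum_cells) (use assms in \<open>auto simp: lebesgue_partition_def\<close>)

lemma measurable_cell_average:
  assumes "lebesgue_partition A d I P"
  shows "cell_average I P f \<in> borel_measurable (lebesgue_on A)"
proof -
  have "P i \<inter> A \<in> sets (lebesgue_on A)" if "i \<in> I" for i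
    using that assms by (auto simp: lebesgue_partition_def sets_restrict_space)
  then show ?thesis
    unfolding cell_average_def[abs_def]
    by (intro borel_measurable_sum borel_measurable_times borel_measurable_const borel_measurable_indicator')
     (auto simp: Int_commute Int_def)
qed

lemma lebesgue_partition_sets:
  assumes "lebesgue_partition A d I P"
  shows "A \<in> sets lebesgue" "i \<in> I \<Longrightarrow> P i \<in> sets lebesgue" "i \<in> I \<Longrightarrow> P i \<subseteq> A"
  using assms by (auto simp: lebesgue_partition_def)

lemma lebesgue_partition_cell:
  assumes "lebesgue_partition A d I P" "x \<in> A"
  obtains i where "i \<in> I" "x \<in> P i"
  using assms by (auto simp: lebesgue_partition_def)

lemma integrable_on_cell:
  fixes f :: "'a::euclidean_space \<Rightarrow> real"
  assumes "lebesgue_partition A d I P" "i \<in> I" "integrable (lebesgue_on A) f"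
  shows "integrable (lebesgue_on (P i)) f"
proof -
  note s = lebesgue_partition_sets[OF assms(1)]
  have "indicator (P i) x * (indicator A x * f x) = indicator (P i) x * f x" for x
    using s(3)[OF assms(2)] by (auto simp: indicator_def)
  moreover have "integrable lebesgue (\<lambda>x. indicator (P i) x * (indicator A x * f x))"
    using integrable_mult_indicator[of "P i" lebesgue "\<lambda>x. indicator A x * f x"] assms s
    by (simp add: integrable_restrict_space)
  ultimately have "integrable lebesgue (\<lambda>x. indicator (P i) x * f x)"
    by presburger
  then show ?thesis
    using s assms by (simp add: integrable_restrict_space)
qed

lemma integral_partition:
  fixes f :: "'a::euclidean_space \<Rightarrow> real"
  assumes P: "lebesgue_partition A d I P" and f: "integrable (lebesgue_on A) f"
  shows "(LINT x|lebesgue_on A. f x) = (\<Sum>i\<in>I. LINT x|lebesgue_on (P i). f x)"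
proof -
  note s = lebesgue_partition_sets[OF P]
  have "(\<Sum>i\<in>I. f x * indicator (P i) x) = indicator A x * f x" for x
  proof (cases "x \<in> A")
    case True
    then obtain i where "i \<in> I" "x \<in> P i"
      using lebesgue_partition_cell[OF P] by blast
    then show ?thesis
      using sum_cells[of I P i x "\<lambda>_. f x"] P True by (auto simp: lebesgue_partition_def)
  next
    case False
    then have "\<forall>i\<in>I. x \<notin> P i" using s by blast
    then show ?thesis using False by simp
  qed
  then have "(LINT x|lebesgue_on A. f x) = (LINT x|lebesgue. (\<Sum>i\<in>I. f x * indicator (P i) x))"
    using s by (simp add: integral_restrict_space)
  also have "\<dots> = (\<Sum>i\<in>I. LINT x|lebesgue. f x * indicator (P i) x)"
    using integrable_on_cell[OF P _ f] s
    by (intro Bochner_Integration.integral_sum) (auto simp: integrable_restrict_space mult.commute)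
  also have "\<dots> = (\<Sum>i\<in>I. LINT x|lebesgue_on (P i). f x)"
    using s by (intro sum.cong) (auto simp: integral_restrict_space mult.commute)
  finally show ?thesis .
qed

text \<open>
  The integral of \<open>(f - b)\<^sup>2\<close> is a quadratic polynomial in \<open>b\<close> with its minimum at the mean of \<open>f\<close>.
\<close>

lemma mean_best_constant:
  fixes f :: "'a \<Rightarrow> real"
  assumes "finite_measure M" "f \<in> borel_measurable M" "integrable M (\<lambda>x. (f x)\<^sup>2)"
  shows "(LINT x|M. (f x - (LINT y|M. f y) / measure M (space M))\<^sup>2) \<le> (LINT x|M. (f x - a)\<^sup>2)"
proof -
  interpret finite_measure M by fact
  have f: "integrable M f"
    using assms(2,3) by (rule square_integrable_imp_integrable)
  define V where "V = measure M (space M)"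
  define m where "m = (LINT y|M. f y) / V"
  have *: "(LINT x|M. (f x - b)\<^sup>2) = (LINT x|M. (f x)\<^sup>2) - 2 * b * (LINT x|M. f x) + b\<^sup>2 * V" for b
    using f assms(3) by (simp add: power2_diff V_def mult.assoc mult.left_commute[of _ "f _"])
  have fm: "(LINT y|M. f y) = m * V"
  proof (cases "V = 0")
    case True
    then have "AE x in M. f x = 0"
      using AE_iff_measurable[of "space M" M] by (auto simp: V_def emeasure_eq_measure intro!: AE_I[of _ _ "space M"])
    then show ?thesis
      using True by (simp add: integral_eq_zero_AE)
  qed (simp add: m_def)
  have "(LINT x|M. (f x - a)\<^sup>2) - (LINT x|M. (f x - m)\<^sup>2) = V * (m - a)\<^sup>2"
    unfolding * fm by (simp add: power2_eq_square algebra_simps)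
  moreover have "0 \<le> V * (m - a)\<^sup>2"
    by (simp add: V_def)
  ultimately have "(LINT x|M. (f x - m)\<^sup>2) \<le> (LINT x|M. (f x - a)\<^sup>2)"
    by linarith
  then show ?thesis
    by (simp add: m_def V_def)
qed

text \<open>
  On each cell the average does at least as well as the constant value of \<open>h\<close> at one of its points,
  and that constant is within \<open>\<eta>\<close> of \<open>h\<close> on the whole cell.
\<close>

lemma cell_average_error:
  fixes f h :: "'a::euclidean_space \<Rightarrow> real"
  assumes P: "lebesgue_partition A d I P" and A: "A \<in> lmeasurable"
    and f: "f \<in> borel_measurable (lebesgue_on A)" "integrable (lebesgue_on A) (\<lambda>x. (f x)\<^sup>2)"
    and fh: "integrable (lebesgue_on A) (\<lambda>x. (f x - h x)\<^sup>2)"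
    and osc: "\<And>i x y. i \<in> I \<Longrightarrow> x \<in> P i \<Longrightarrow> y \<in> P i \<Longrightarrow> \<bar>h x - h y\<bar> \<le> \<eta>"
  shows "integrable (lebesgue_on A) (\<lambda>x. (f x - cell_average I P f x)\<^sup>2)"
    and "(LINT x|lebesgue_on A. (f x - cell_average I P f x)\<^sup>2)
      \<le> 2 * (LINT x|lebesgue_on A. (f x - h x)\<^sup>2) + 2 * \<eta>\<^sup>2 * measure lebesgue A"
proof -
  note s = lebesgue_partition_sets[OF P]
  interpret finite_measure "lebesgue_on A"
    using A by (rule finite_measure_lebesgue_on)
  let ?avg = "cell_average I P f"
  have fi: "integrable (lebesgue_on A) f"
    using f by (rule square_integrable_imp_integrable)
  have avg_m [measurable]: "?avg \<in> borel_measurable (lebesgue_on A)"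
    using P by (rule measurable_cell_average)
  have fin: "finite I"
    using P by (simp add: lebesgue_partition_def)
  have avg_bd: "\<bar>?avg x\<bar> \<le> (\<Sum>i\<in>I. \<bar>(LINT y|lebesgue_on (P i). f y) / measure lebesgue (P i)\<bar>)" for x
    unfolding cell_average_def
    by (rule order_trans[OF sum_abs sum_mono]) (auto simp: abs_mult indicator_def)
  define B where "B = (\<Sum>i\<in>I. \<bar>(LINT y|lebesgue_on (P i). f y) / measure lebesgue (P i)\<bar>)"
  have "integrable (lebesgue_on A) (\<lambda>x. 2 * (f x)\<^sup>2 + 2 * B\<^sup>2)"
    using f by simp
  moreover have "(f x - ?avg x)\<^sup>2 \<le> 2 * (f x)\<^sup>2 + 2 * B\<^sup>2" for x
  proof -
    have "(?avg x)\<^sup>2 \<le> B\<^sup>2"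
      using avg_bd[of x] by (intro abs_le_square_iff[THEN iffD1]) (simp add: B_def)
    then show ?thesis
      using square_sum_le[of "f x" "- ?avg x"] by simp
  qed
  ultimately show int: "integrable (lebesgue_on A) (\<lambda>x. (f x - ?avg x)\<^sup>2)"
    using f by (elim Bochner_Integration.integrable_bound) auto
  have cell: "(LINT x|lebesgue_on (P i). (f x - ?avg x)\<^sup>2)
      \<le> (LINT x|lebesgue_on (P i). 2 * (f x - h x)\<^sup>2 + 2 * \<eta>\<^sup>2)" if i: "i \<in> I" for i
  proof (cases "P i = {}")
    case False
    then obtain p where p: "p \<in> P i" by blast
    have Pi: "P i \<in> lmeasurable"
      using s i A by (meson fmeasurableI2)
    interpret Pi: finite_measure "lebesgue_on (P i)"
      using Pi by (rule finite_measure_lebesgue_on)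
    have fP: "f \<in> borel_measurable (lebesgue_on (P i))" "integrable (lebesgue_on (P i)) (\<lambda>x. (f x)\<^sup>2)"
      using integrable_on_cell[OF P i] fi f by auto
    then have fPi: "integrable (lebesgue_on (P i)) f"
      by (rule Pi.square_integrable_imp_integrable)
    have "(LINT x|lebesgue_on (P i). (f x - ?avg x)\<^sup>2) =
        (LINT x|lebesgue_on (P i). (f x - (LINT y|lebesgue_on (P i). f y) / measure (lebesgue_on (P i)) (space (lebesgue_on (P i))))\<^sup>2)"
      using cell_average_eq[OF P i] s(2)[OF i]
      by (intro Bochner_Integration.integral_cong) (auto simp: measure_restrict_space)
    also have "\<dots> \<le> (LINT x|lebesgue_on (P i). (f x - h p)\<^sup>2)"
      using Pi.finite_measure_axioms fP by (rule mean_best_constant)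
    also have "\<dots> \<le> (LINT x|lebesgue_on (P i). 2 * (f x - h x)\<^sup>2 + 2 * \<eta>\<^sup>2)"
    proof (intro integral_mono)
      show "integrable (lebesgue_on (P i)) (\<lambda>x. (f x - h p)\<^sup>2)"
        using fP fPi by (simp add: power2_diff)
      show "integrable (lebesgue_on (P i)) (\<lambda>x. 2 * (f x - h x)\<^sup>2 + 2 * \<eta>\<^sup>2)"
        using integrable_on_cell[OF P i fh] by simp
      fix x assume "x \<in> space (lebesgue_on (P i))"
      then have "\<bar>h x - h p\<bar> \<le> \<eta>"
        using osc[OF i _ p] by simp
      then have "(h x - h p)\<^sup>2 \<le> \<eta>\<^sup>2"
        by (intro abs_le_square_iff[THEN iffD1]) simp
      then show "(f x - h p)\<^sup>2 \<le> 2 * (f x - h x)\<^sup>2 + 2 * \<eta>\<^sup>2"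
        using square_sum_le[of "f x - h x" "h x - h p"] by simp
    qed
    finally show ?thesis .
  qed simp
  have "(LINT x|lebesgue_on A. (f x - ?avg x)\<^sup>2) = (\<Sum>i\<in>I. LINT x|lebesgue_on (P i). (f x - ?avg x)\<^sup>2)"
    by (rule integral_partition[OF P int])
  also have "\<dots> \<le> (\<Sum>i\<in>I. LINT x|lebesgue_on (P i). 2 * (f x - h x)\<^sup>2 + 2 * \<eta>\<^sup>2)"
    by (rule sum_mono[OF cell])
  also have "\<dots> = (LINT x|lebesgue_on A. 2 * (f x - h x)\<^sup>2 + 2 * \<eta>\<^sup>2)"
    by (rule integral_partition[OF P, symmetric]) (use fh in simp)
  also have "\<dots> = 2 * (LINT x|lebesgue_on A. (f x - h x)\<^sup>2) + 2 * \<eta>\<^sup>2 * measure lebesgue A"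
    using fh s by (simp add: measure_restrict_space)
  finally show "(LINT x|lebesgue_on A. (f x - ?avg x)\<^sup>2)
      \<le> 2 * (LINT x|lebesgue_on A. (f x - h x)\<^sup>2) + 2 * \<eta>\<^sup>2 * measure lebesgue A" .
qed

proposition cell_averages_converge:
  fixes f :: "'a::euclidean_space \<Rightarrow> real"
  assumes A: "compact A" and f: "f \<in> borel_measurable (lebesgue_on A)"
    and f2: "integrable (lebesgue_on A) (\<lambda>x. (f x)\<^sup>2)" and e: "0 < e"
  shows "\<exists>d>0. \<forall>(I :: 'i set) P. lebesgue_partition A d I P \<longrightarrow>
      integrable (lebesgue_on A) (\<lambda>x. (f x - cell_average I P f x)\<^sup>2) \<and>
      (LINT x|lebesgue_on A. (f x - cell_average I P f x)\<^sup>2) < e"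
proof -
  have Am: "A \<in> lmeasurable"
    using A by (rule lmeasurable_compact)
  obtain h where h: "continuous_on UNIV h" 
    and fh: "integrable (lebesgue_on A) (\<lambda>x. (f x - h x)\<^sup>2)"
    and fhe: "(LINT x|lebesgue_on A. (f x - h x)\<^sup>2) < e / 4"
    using square_integrable_near_continuous[OF Am f f2, of "e / 4"] e by auto
  define V where "V = measure lebesgue A"
  have V: "0 \<le> V" by (simp add: V_def)
  \<comment> \<open>The choice of \<open>\<eta>\<close> makes \<open>2 \<eta>\<^sup>2 V\<close> at most \<open>e/2\<close>; adding 1 to \<open>V\<close> covers sets of measure zero.\<close>
  define \<eta> where "\<eta> = sqrt (e / (4 * (V + 1)))"
  have "0 < e / (4 * (V + 1))"
    using e V by (intro divide_pos_pos) auto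
  then have "0 < \<eta>" "4 * \<eta>\<^sup>2 * (V + 1) = e"
    using V unfolding \<eta>_def by (simp_all add: field_simps)
  moreover have "4 * \<eta>\<^sup>2 * V \<le> 4 * \<eta>\<^sup>2 * (V + 1)"
    by (intro mult_left_mono) auto
  ultimately have \<eta>: "0 < \<eta>" "2 * \<eta>\<^sup>2 * V \<le> e / 2"
    by simp_all
  have "uniformly_continuous_on A h"
    using A h by (intro compact_uniformly_continuous) (auto intro: continuous_on_subset)
  then obtain d where d: "0 < d" "\<And>x y. x \<in> A \<Longrightarrow> y \<in> A \<Longrightarrow> dist x y < d \<Longrightarrow> dist (h x) (h y) < \<eta>"
    using \<eta>(1) by (metis uniformly_continuous_on_def dist_commute)
  show ?thesis
  proof (intro exI[of _ d] conjI d(1) allI impI)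
    fix I :: "'i set" and P assume P: "lebesgue_partition A d I P"
    have osc: "\<bar>h x - h y\<bar> \<le> \<eta>" if "i \<in> I" "x \<in> P i" "y \<in> P i" for i x y
      using d(2)[of x y] that P lebesgue_partition_sets(3)[OF P that(1)]
      by (force simp: lebesgue_partition_def dist_real_def)
    show "integrable (lebesgue_on A) (\<lambda>x. (f x - cell_average I P f x)\<^sup>2)"
      by (rule cell_average_error(1)[OF P Am f f2 fh osc])
    have "(LINT x|lebesgue_on A. (f x - cell_average I P f x)\<^sup>2)
        \<le> 2 * (LINT x|lebesgue_on A. (f x - h x)\<^sup>2) + 2 * \<eta>\<^sup>2 * V"
      unfolding V_def by (rule cell_average_error(2)[OF P Am f f2 fh osc])
    then show "(LINT x|lebesgue_on A. (f x - cell_average I P f x)\<^sup>2) < e"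
      using fhe \<eta>(2) by linarith
  qed
qed

section \<open>Inner product and norm on \<open>L\<^sup>2[0,1]\<close>\<close>

lemma finite_unit_leb: "finite_measure unit_leb"
  by (rule finite_measure_lebesgue_on) simp

lemma measure_unit_leb [simp]: "measure unit_leb {0..1} = 1"
  by (simp add: measure_restrict_space)

definition L2_inner :: "(real \<Rightarrow> real) \<Rightarrow> (real \<Rightarrow> real) \<Rightarrow> real" where
  "L2_inner f g = (LINT x|unit_leb. f x * g x)"

lemma L2_integrable_mult:
  assumes "f \<in> L2" "g \<in> L2"
  shows "integrable unit_leb (\<lambda>x. f x * g x)"
proof (rule Bochner_Integration.integrable_bound)
  show "integrable unit_leb (\<lambda>x. (f x)\<^sup>2 + (g x)\<^sup>2)"
    using assms by (simp add: L2_def)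
  show "(\<lambda>x. f x * g x) \<in> borel_measurable unit_leb"
    using assms by (auto simp: L2_def intro!: borel_measurable_times)
  have "\<bar>a * b\<bar> \<le> a\<^sup>2 + b\<^sup>2" for a b :: real
  proof -
    have "2 * \<bar>a * b\<bar> \<le> a\<^sup>2 + b\<^sup>2"
      using sum_squares_bound[of "\<bar>a\<bar>" "\<bar>b\<bar>"] by (simp add: abs_mult)
    then show ?thesis
      using abs_ge_zero[of "a * b"] by linarith
  qed
  then show "AE x in unit_leb. norm (f x * g x) \<le> norm ((f x)\<^sup>2 + (g x)\<^sup>2)"
    by (intro AE_I2) simp
qed

lemma L2_integrable: "f \<in> L2 \<Longrightarrow> integrable unit_leb f"
  using finite_measure.square_integrable_imp_integrable[OF finite_unit_leb] by (auto simp: L2_def)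

lemma L2_cmult: "f \<in> L2 \<Longrightarrow> (\<lambda>x. c * f x) \<in> L2"
  by (auto simp: L2_def power_mult_distrib intro!: borel_measurable_times)

lemma L2_add: "f \<in> L2 \<Longrightarrow> g \<in> L2 \<Longrightarrow> (\<lambda>x. f x + g x) \<in> L2"
  using L2_integrable_mult[of f g] by (auto simp: L2_def power2_sum mult.assoc intro!: borel_measurable_add)

lemma L2_diff: "f \<in> L2 \<Longrightarrow> g \<in> L2 \<Longrightarrow> (\<lambda>x. f x - g x) \<in> L2"
  using L2_integrable_mult[of f g] by (auto simp: L2_def power2_diff mult.assoc intro!: borel_measurable_diff)

lemma L2_inner_add_right:
  "f \<in> L2 \<Longrightarrow> g \<in> L2 \<Longrightarrow> h \<in> L2 \<Longrightarrow> L2_inner f (\<lambda>x. g x + h x) = L2_inner f g + L2_inner f h"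
  by (simp add: L2_inner_def distrib_left L2_integrable_mult)

lemma L2_inner_cmult_right: "L2_inner f (\<lambda>x. c * g x) = c * L2_inner f g"
  by (simp add: L2_inner_def mult.left_commute)

lemma L2_inner_commute: "L2_inner f g = L2_inner g f"
  by (simp add: L2_inner_def mult.commute)

lemma L2_norm_nonneg [simp]: "0 \<le> L2_norm f"
  by (simp add: L2_norm_def)

lemma L2_norm_square: "(L2_norm f)\<^sup>2 = (LINT x|unit_leb. (f x)\<^sup>2)"
  by (simp add: L2_norm_def)

lemma L2_norm_square_add:
  assumes "f \<in> L2" "g \<in> L2"
  shows "(L2_norm (\<lambda>x. f x + g x))\<^sup>2 = (L2_norm f)\<^sup>2 + 2 * L2_inner f g + (L2_norm g)\<^sup>2"
  using assms L2_integrable_mult[of f g]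
  by (simp add: L2_norm_square L2_inner_def L2_def power2_sum mult.assoc)

lemma L2_norm_cmult: "L2_norm (\<lambda>x. c * f x) = \<bar>c\<bar> * L2_norm f"
  by (simp add: L2_norm_def power_mult_distrib real_sqrt_mult)

lemma L2_Cauchy_Schwarz:
  assumes f: "f \<in> L2" and g: "g \<in> L2"
  shows "\<bar>L2_inner f g\<bar> \<le> L2_norm f * L2_norm g"
proof -
  define a b c where abc: "a = (L2_norm f)\<^sup>2" "b = (L2_norm g)\<^sup>2" "c = L2_inner f g"
  \<comment> \<open>The squared norm of \<open>f + t g\<close>, a polynomial in \<open>t\<close> without negative values.\<close>
  have quad: "0 \<le> a + 2 * t * c + t\<^sup>2 * b" for t
    using L2_norm_square_add[OF f L2_cmult[OF g, of t]]
    by (simp add: abc L2_norm_cmult L2_inner_cmult_right power_mult_distrib mult.assoc)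
      (metis zero_le_power2)
  have "c\<^sup>2 \<le> a * b"
  proof (cases "b = 0")
    case True
    have "c = 0"
    proof (rule ccontr)
      assume "c \<noteq> 0"
      then show False
        using quad[of "- (a + 1) / (2 * c)"] True by (simp add: field_simps)
    qed
    then show ?thesis using True by simp
  next
    case False
    then have "0 < b" by (simp add: abc)
    then show ?thesis
      using quad[of "- c / b"] by (simp add: power2_eq_square field_simps)
  qed
  then show ?thesis
    by (intro abs_le_square_iff[THEN iffD2, of _ "L2_norm f * L2_norm g", simplified])
      (simp add: abc power_mult_distrib)
qed

lemma L2_norm_triangle:
  assumes "f \<in> L2" "g \<in> L2"
  shows "L2_norm (\<lambda>x. f x + g x) \<le> L2_norm f + L2_norm g"
proof (rule power2_le_imp_le)
  show "(L2_norm (\<lambda>x. f x + g x))\<^sup>2 \<le> (L2_norm f + L2_norm g)\<^sup>2"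
    using L2_Cauchy_Schwarz[OF assms] by (simp add: L2_norm_square_add[OF assms] power2_sum)
qed simp

lemma L2_norm_triangle_diff:
  assumes "f \<in> L2" "g \<in> L2"
  shows "L2_norm (\<lambda>x. f x - g x) \<le> L2_norm f + L2_norm g"
  using L2_norm_triangle[OF assms(1) L2_cmult[OF assms(2), of "-1"]] L2_norm_cmult[of "-1" g] by simp

lemma bounded_function_in_L2:
  assumes "f \<in> borel_measurable unit_leb" "\<And>x. x \<in> {0..1} \<Longrightarrow> \<bar>f x\<bar> \<le> B"
  shows "f \<in> L2"
proof -
  interpret finite_measure unit_leb by (rule finite_unit_leb)
  have "(f x)\<^sup>2 \<le> B\<^sup>2" if "x \<in> {0..1}" for x
    using assms(2)[OF that] by (intro abs_le_square_iff[THEN iffD1]) simp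
  then have "integrable unit_leb (\<lambda>x. (f x)\<^sup>2)"
    using assms(1) by (intro integrable_const_bound[where B="B\<^sup>2"] AE_I2) auto
  then show ?thesis
    using assms(1) by (simp add: L2_def)
qed

lemma L2_abs: "f \<in> L2 \<Longrightarrow> (\<lambda>x. \<bar>f x\<bar>) \<in> L2"
  by (auto simp: L2_def intro!: borel_measurable_abs)

lemma integral_abs_le_L2_norm:
  assumes "f \<in> L2"
  shows "(LINT x|unit_leb. \<bar>f x\<bar>) \<le> L2_norm f"
proof -
  have "(\<lambda>x. 1) \<in> L2"
    by (rule bounded_function_in_L2[of _ 1]) auto
  then have "\<bar>L2_inner (\<lambda>x. \<bar>f x\<bar>) (\<lambda>x. 1)\<bar> \<le> L2_norm (\<lambda>x. \<bar>f x\<bar>) * L2_norm (\<lambda>x. 1)"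
    by (rule L2_Cauchy_Schwarz[OF L2_abs[OF assms]])
  then show ?thesis
    by (simp add: L2_inner_def L2_norm_def)
qed

section \<open>Energy estimates\<close>

lemma has_L2_derivative_diff:
  assumes t: "t \<in> T" and L2: "\<And>s. s \<in> T \<Longrightarrow> u s \<in> L2" "\<And>s. s \<in> T \<Longrightarrow> v s \<in> L2" "u' \<in> L2" "v' \<in> L2"
    and "has_L2_derivative_within u u' t T" "has_L2_derivative_within v v' t T"
  shows "has_L2_derivative_within (\<lambda>s x. u s x - v s x) (\<lambda>x. u' x - v' x) t T"
proof -
  define q where "q v v' s x = (v s x - v t x) / (s - t) - v' x" for v :: "real \<Rightarrow> real \<Rightarrow> real" and v' s x
  have qL2: "q v v' s \<in> L2" if "s \<in> T" "\<And>s. s \<in> T \<Longrightarrow> v s \<in> L2" "v' \<in> L2" for v v' s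
    using L2_diff[OF L2_cmult[OF L2_diff[OF that(2)[OF that(1)] that(2)[OF t]], of "1 / (s - t)"] that(3)]
    by (simp add: q_def[abs_def])
  have "((\<lambda>s. L2_norm (q u u' s) + L2_norm (q v v' s)) \<longlongrightarrow> 0 + 0) (at t within T)"
    using assms(6,7) by (intro tendsto_add) (simp_all add: has_L2_derivative_within_def q_def[abs_def])
  then have lim: "((\<lambda>s. L2_norm (q u u' s) + L2_norm (q v v' s)) \<longlongrightarrow> 0) (at t within T)"
    by simp
  have bound: "L2_norm (\<lambda>x. q u u' s x - q v v' s x) \<le> L2_norm (q u u' s) + L2_norm (q v v' s)" if "s \<in> T" for s
    using that L2 by (intro L2_norm_triangle_diff qL2) auto
  have eq: "(\<lambda>x. ((u s x - v s x) - (u t x - v t x)) / (s - t) - (u' x - v' x)) =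
      (\<lambda>x. q u u' s x - q v v' s x)" for s
    by (rule ext) (simp add: q_def diff_divide_distrib)
  show ?thesis
    unfolding has_L2_derivative_within_def eq
    by (rule Lim_null_comparison[OF _ lim]) (use bound in \<open>auto simp: eventually_at_filter\<close>)
qed

text \<open>
  The error \<open>q\<close> of the difference quotient tends to 0 in norm. Substituting
  \<open>v s = v t + (s - t) (q s + d)\<close> into the squared norm shows that its difference quotient is
  \<open>2 \<langle>d, v t\<rangle>\<close> up to a term linear in \<open>q s\<close> and a term with a factor \<open>s - t\<close>.
\<close>

lemma L2_norm_square_has_derivative:
  assumes t: "t \<in> T" and v: "\<And>s. s \<in> T \<Longrightarrow> v s \<in> L2" and d: "d \<in> L2"
    and der: "has_L2_derivative_within v d t T"
  shows "((\<lambda>s. (L2_norm (v s))\<^sup>2) has_real_derivative 2 * L2_inner d (v t)) (at t within T)"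
proof -
  define q where "q s x = (v s x - v t x) / (s - t) - d x" for s x
  have q: "q s \<in> L2" if "s \<in> T" for s
    using L2_diff[OF L2_cmult[OF L2_diff[OF v[OF that] v[OF t]], of "1 / (s - t)"] d]
    by (simp add: q_def[abs_def])
  have q0: "((\<lambda>s. L2_norm (q s)) \<longlongrightarrow> 0) (at t within T)"
    using der by (simp add: has_L2_derivative_within_def q_def[abs_def])
  have quot: "((L2_norm (v s))\<^sup>2 - (L2_norm (v t))\<^sup>2) / (s - t) - 2 * L2_inner d (v t)
      = 2 * L2_inner (v t) (q s) + (s - t) * (L2_norm (\<lambda>x. q s x + d x))\<^sup>2"
    if s: "s \<in> T" "s \<noteq> t" for s
  proof -
    have "v s = (\<lambda>x. v t x + (s - t) * (q s x + d x))"
      using s by (auto simp: q_def)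
    then have "(L2_norm (v s))\<^sup>2 = (L2_norm (v t))\<^sup>2 + 2 * ((s - t) * (L2_inner (v t) (q s) + L2_inner (v t) d))
        + (s - t)\<^sup>2 * (L2_norm (\<lambda>x. q s x + d x))\<^sup>2"
      using L2_norm_square_add[OF v[OF t] L2_cmult[OF L2_add[OF q[OF s(1)] d], of "s - t"]]
      by (simp add: L2_inner_cmult_right L2_inner_add_right v[OF t] q[OF s(1)] d L2_norm_cmult power_mult_distrib)
    then show ?thesis
      using s(2) by (simp add: L2_inner_commute[of d] power2_eq_square field_simps)
  qed
  have bound: "\<bar>((L2_norm (v s))\<^sup>2 - (L2_norm (v t))\<^sup>2) / (s - t) - 2 * L2_inner d (v t)\<bar>
      \<le> 2 * (L2_norm (v t) * L2_norm (q s)) + \<bar>s - t\<bar> * (L2_norm (q s) + L2_norm d)\<^sup>2"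
    if s: "s \<in> T" "s \<noteq> t" for s
  proof -
    have "(L2_norm (\<lambda>x. q s x + d x))\<^sup>2 \<le> (L2_norm (q s) + L2_norm d)\<^sup>2"
      using L2_norm_triangle[OF q[OF s(1)] d] by (intro power_mono) auto
    then have "\<bar>s - t\<bar> * (L2_norm (\<lambda>x. q s x + d x))\<^sup>2 \<le> \<bar>s - t\<bar> * (L2_norm (q s) + L2_norm d)\<^sup>2"
      by (rule mult_left_mono) simp
    moreover have "\<bar>(s - t) * (L2_norm (\<lambda>x. q s x + d x))\<^sup>2\<bar> = \<bar>s - t\<bar> * (L2_norm (\<lambda>x. q s x + d x))\<^sup>2"
      by (simp add: abs_mult)
    ultimately show ?thesis
      unfolding quot[OF s] using L2_Cauchy_Schwarz[OF v[OF t] q[OF s(1)]] by linarith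
  qed
  have "((\<lambda>s. 2 * (L2_norm (v t) * L2_norm (q s)) + \<bar>s - t\<bar> * (L2_norm (q s) + L2_norm d)\<^sup>2) \<longlongrightarrow>
      2 * (L2_norm (v t) * 0) + \<bar>t - t\<bar> * (0 + L2_norm d)\<^sup>2) (at t within T)"
    by (intro tendsto_intros q0)
  then have lim: "((\<lambda>s. 2 * (L2_norm (v t) * L2_norm (q s)) + \<bar>s - t\<bar> * (L2_norm (q s) + L2_norm d)\<^sup>2) \<longlongrightarrow> 0)
      (at t within T)"
    by simp
  have "((\<lambda>s. ((L2_norm (v s))\<^sup>2 - (L2_norm (v t))\<^sup>2) / (s - t) - 2 * L2_inner d (v t)) \<longlongrightarrow> 0) (at t within T)"
    by (rule Lim_null_comparison[OF _ lim]) (use bound in \<open>auto simp: eventually_at_filter\<close>)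
  then show ?thesis
    by (simp add: has_field_derivative_iff LIM_zero_cancel)
qed

text \<open>
  Gronwall's inequality for the energy \<open>\<phi> s = \<parallel>v s\<parallel>\<^sup>2\<close>: the function \<open>exp (- a s) \<phi> s - b s\<close> is
  nonincreasing, because its derivative is at most \<open>b (exp (- a s) - 1)\<close>.
\<close>

lemma energy_estimate:
  assumes t: "0 \<le> t" and a: "0 \<le> a" and b: "0 \<le> b"
    and v: "\<And>s. 0 \<le> s \<Longrightarrow> v s \<in> L2" "\<And>s. 0 \<le> s \<Longrightarrow> v' s \<in> L2"
    and der: "\<And>s. 0 \<le> s \<Longrightarrow> has_L2_derivative_within v (v' s) s {0..}"
    and le: "\<And>s. 0 \<le> s \<Longrightarrow> s \<le> t \<Longrightarrow> 2 * L2_inner (v' s) (v s) \<le> a * (L2_norm (v s))\<^sup>2 + b"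
  shows "(L2_norm (v t))\<^sup>2 \<le> exp (a * t) * ((L2_norm (v 0))\<^sup>2 + b * t)"
proof (cases "t = 0")
  case False
  then have t: "0 < t" using t by simp
  define \<phi> where "\<phi> s = (L2_norm (v s))\<^sup>2" for s
  define \<psi> where "\<psi> s = exp (- a * s) * \<phi> s - b * s" for s
  have \<phi>: "(\<phi> has_real_derivative 2 * L2_inner (v' s) (v s)) (at s within {0..})" if "0 \<le> s" for s
    unfolding \<phi>_def[abs_def] using that by (intro L2_norm_square_has_derivative der v) auto
  have \<psi>: "(\<psi> has_real_derivative exp (- a * s) * (2 * L2_inner (v' s) (v s) - a * \<phi> s) - b) (at s within {0..})"
    if "0 \<le> s" for s
    unfolding \<psi>_def[abs_def]
    by (rule derivative_eq_intros \<phi>[OF that] refl)+ (simp add: algebra_simps)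
  have "\<psi> t \<le> \<psi> 0"
  proof (rule DERIV_nonpos_imp_decreasing_open[OF less_imp_le[OF t]])
    fix s assume s: "0 < s" "s < t"
    have "at s within {0..} = at s"
      using s by (intro at_within_interior) (auto simp: interior_real_atLeast)
    then have "(\<psi> has_real_derivative exp (- a * s) * (2 * L2_inner (v' s) (v s) - a * \<phi> s) - b) (at s)"
      using \<psi>[of s] s by simp
    moreover have "exp (- a * s) * (2 * L2_inner (v' s) (v s) - a * \<phi> s) \<le> b"
    proof -
      have "exp (- a * s) * (2 * L2_inner (v' s) (v s) - a * \<phi> s) \<le> exp (- a * s) * b"
        using le[of s] s by (intro mult_left_mono) (auto simp: \<phi>_def)
      also have "\<dots> \<le> 1 * b"
        using a s b by (intro mult_right_mono) auto
      finally show ?thesis by simp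
    qed
    ultimately show "\<exists>y. (\<psi> has_real_derivative y) (at s) \<and> y \<le> 0"
      by (intro exI conjI) auto
  next
    show "continuous_on {0..t} \<psi>"
      by (rule continuous_on_subset[of "{0..}"], rule DERIV_continuous_on[OF \<psi>]) auto
  qed
  then have "exp (- a * t) * \<phi> t \<le> \<phi> 0 + b * t"
    by (simp add: \<psi>_def)
  then have "exp (a * t) * (exp (- a * t) * \<phi> t) \<le> exp (a * t) * (\<phi> 0 + b * t)"
    by (rule mult_left_mono) simp
  then show ?thesis
    by (simp add: \<phi>_def mult.assoc[symmetric] exp_add[symmetric])
qed simp

text \<open>
  The assumption is an almost everywhere bound on \<open>e' + e = K e + r\<close>, where \<open>d\<close> dominates \<open>r\<^sup>2\<close>.
  Bounding the integrand pointwise keeps the functions \<open>K e\<close> and \<open>r\<close> out of the integrals, so that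
  their measurability need not be established separately. The damping term \<open>- e\<close> contributes
  \<open>- 2 e\<^sup>2\<close>, which absorbs the \<open>e\<^sup>2\<close> from \<open>2 r e \<le> r\<^sup>2 + e\<^sup>2\<close>.
\<close>

lemma L2_inner_le_of_pointwise_bound:
  assumes e: "e \<in> L2" and e': "e' \<in> L2" and C: "0 \<le> C" and d: "integrable unit_leb d"
    and bd: "AE x in unit_leb. 0 \<le> d x \<and> \<bar>e' x + e x\<bar> \<le> C * L2_norm e + sqrt (d x)"
  shows "2 * L2_inner e' e \<le> 2 * C * (L2_norm e)\<^sup>2 + (LINT x|unit_leb. d x)"
proof -
  define M where "M = C * L2_norm e"
  have M: "0 \<le> M" using C by (simp add: M_def)
  have "2 * L2_inner e' e = (LINT x|unit_leb. 2 * (e' x * e x))"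
    by (simp add: L2_inner_def)
  also have "\<dots> \<le> (LINT x|unit_leb. 2 * M * \<bar>e x\<bar> + d x)"
  proof (rule integral_mono_AE)
    show "AE x in unit_leb. 2 * (e' x * e x) \<le> 2 * M * \<bar>e x\<bar> + d x"
      using bd
    proof eventually_elim
      case (elim x)
      have "(e' x + e x) * e x \<le> \<bar>e' x + e x\<bar> * \<bar>e x\<bar>"
        by (metis abs_ge_self abs_mult)
      also have "\<dots> \<le> (M + sqrt (d x)) * \<bar>e x\<bar>"
        using elim by (intro mult_right_mono) (auto simp: M_def)
      finally have "2 * (e' x * e x) \<le> 2 * M * \<bar>e x\<bar> + 2 * sqrt (d x) * \<bar>e x\<bar> - 2 * (e x)\<^sup>2"
        by (simp add: algebra_simps power2_eq_square)
      moreover have "2 * sqrt (d x) * \<bar>e x\<bar> \<le> d x + (e x)\<^sup>2"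
        using sum_squares_bound[of "sqrt (d x)" "\<bar>e x\<bar>"] elim by simp
      ultimately show ?case
        using zero_le_power2[of "e x"] by linarith
    qed
  qed (use L2_integrable_mult[OF e' e] L2_integrable[OF e] d in auto)
  also have "\<dots> = 2 * M * (LINT x|unit_leb. \<bar>e x\<bar>) + (LINT x|unit_leb. d x)"
    using L2_integrable[OF e] d by simp
  also have "\<dots> \<le> 2 * M * L2_norm e + (LINT x|unit_leb. d x)"
    using integral_abs_le_L2_norm[OF e] M by (intro add_right_mono mult_left_mono) auto
  finally show ?thesis
    by (simp add: M_def power2_eq_square mult.assoc)
qed

section \<open>Dependence of the solution on the kernel\<close>

definition bounded_kernel :: "real \<Rightarrow> (real \<Rightarrow> real \<Rightarrow> real) \<Rightarrow> bool" where
  "bounded_kernel C K \<longleftrightarrow>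
     (\<forall>x\<in>{0..1}. K x \<in> borel_measurable unit_leb \<and> (\<forall>y\<in>{0..1}. \<bar>K x y\<bar> \<le> C))"

lemma bounded_kernel_L2: "bounded_kernel C K \<Longrightarrow> x \<in> {0..1} \<Longrightarrow> K x \<in> L2"
  by (rule bounded_function_in_L2[of _ C]) (auto simp: bounded_kernel_def)

lemma bounded_kernel_integral_le:
  assumes K: "bounded_kernel C K" and f: "f \<in> L2" and x: "x \<in> {0..1}"
  shows "\<bar>LINT y|unit_leb. K x y * f y\<bar> \<le> C * L2_norm f"
proof -
  have C: "0 \<le> C"
    using K x by (force simp: bounded_kernel_def)
  have "\<bar>LINT y|unit_leb. K x y * f y\<bar> \<le> (LINT y|unit_leb. \<bar>K x y * f y\<bar>)"
    by (rule integral_abs_bound)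
  also have "\<dots> \<le> (LINT y|unit_leb. C * \<bar>f y\<bar>)"
  proof (rule integral_mono)
    show "integrable unit_leb (\<lambda>y. \<bar>K x y * f y\<bar>)"
      by (intro integrable_abs L2_integrable_mult bounded_kernel_L2[OF K x] f)
    show "integrable unit_leb (\<lambda>y. C * \<bar>f y\<bar>)"
      using L2_integrable[OF f] by simp
    show "\<bar>K x y * f y\<bar> \<le> C * \<bar>f y\<bar>" if "y \<in> space unit_leb" for y
      using K x that by (auto simp: abs_mult bounded_kernel_def intro!: mult_right_mono)
  qed
  also have "\<dots> \<le> C * L2_norm f"
    using integral_abs_le_L2_norm[OF f] C by (simp add: mult_left_mono)
  finally show ?thesis .
qed

text \<open>
  The splitting \<open>K' f' - K f = K' (f' - f) + (K' - K) f\<close>, evaluated at a point \<open>x\<close>: boundedness of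
  \<open>K'\<close> takes care of the first term and the Cauchy-Schwarz inequality in \<open>y\<close> of the second.
  Integrating \<open>D\<close> over \<open>x\<close> produces the squared Hilbert-Schmidt norm of \<open>K' - K\<close>.
\<close>

lemma kernel_difference_bound:
  assumes K: "bounded_kernel C K" and K': "bounded_kernel C K'"
    and f: "f \<in> L2" and f': "f' \<in> L2" and x: "x \<in> {0..1}"
    and D: "(LINT y|unit_leb. (K' x y - K x y)\<^sup>2) \<le> D"
  shows "\<bar>(LINT y|unit_leb. K' x y * f' y) - (LINT y|unit_leb. K x y * f y)\<bar>
    \<le> C * L2_norm (\<lambda>y. f' y - f y) + sqrt (D * (L2_norm f)\<^sup>2)"
proof -
  note i = L2_integrable_mult bounded_kernel_L2[OF K x] bounded_kernel_L2[OF K' x] f f' L2_diff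
  have "(LINT y|unit_leb. K' x y * f' y) - (LINT y|unit_leb. K x y * f y) =
      (LINT y|unit_leb. K' x y * f' y - K x y * f y)"
    by (rule Bochner_Integration.integral_diff[symmetric]) (intro i)+
  also have "\<dots> = (LINT y|unit_leb. K' x y * (f' y - f y) + (K' x y - K x y) * f y)"
    by (simp add: algebra_simps)
  also have "\<dots> = (LINT y|unit_leb. K' x y * (f' y - f y)) + L2_inner (\<lambda>y. K' x y - K x y) f"
    unfolding L2_inner_def by (rule Bochner_Integration.integral_add) (intro i)+
  finally have eq: "(LINT y|unit_leb. K' x y * f' y) - (LINT y|unit_leb. K x y * f y) = \<dots>" .
  have "L2_norm (\<lambda>y. K' x y - K x y) \<le> sqrt D"
    using D by (simp add: L2_norm_def)
  then have "L2_norm (\<lambda>y. K' x y - K x y) * L2_norm f \<le> sqrt (D * (L2_norm f)\<^sup>2)"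
    by (simp add: real_sqrt_mult mult_right_mono)
  moreover have "\<bar>L2_inner (\<lambda>y. K' x y - K x y) f\<bar> \<le> L2_norm (\<lambda>y. K' x y - K x y) * L2_norm f"
    by (intro L2_Cauchy_Schwarz i)
  moreover have "\<bar>LINT y|unit_leb. K' x y * (f' y - f y)\<bar> \<le> C * L2_norm (\<lambda>y. f' y - f y)"
    by (intro bounded_kernel_integral_le[OF K'] i x)
  ultimately show ?thesis
    unfolding eq by linarith
qed

definition normalized_kernel :: "(real \<Rightarrow> real \<Rightarrow> real) \<Rightarrow> real \<Rightarrow> real \<Rightarrow> real" where
  "normalized_kernel W x y = W x y / graphon_degree W y"

text \<open>
  In the stability estimate the difference of the two operators acts on the reference solution
  \<open>v\<close>, whose norm therefore has to be bounded on the whole interval from 0 to \<open>t\<close>.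
\<close>

lemma classical_solution_growth:
  assumes K: "bounded_kernel C (normalized_kernel W)" and v: "classical_solution W g v" and t: "0 \<le> t"
  shows "(L2_norm (v t))\<^sup>2 \<le> exp (2 * C * t) * (L2_norm (v 0))\<^sup>2"
proof -
  have C: "0 \<le> C"
    using K by (force simp: bounded_kernel_def)
  obtain v' where v': "\<And>s. 0 \<le> s \<Longrightarrow> v' s \<in> L2" "\<And>s. 0 \<le> s \<Longrightarrow> has_L2_derivative_within v (v' s) s {0..}"
    "\<And>s. 0 \<le> s \<Longrightarrow> AE x in unit_leb. v' s x = (LINT y|unit_leb. normalized_kernel W x y * v s y) - v s x"
    and vL2: "\<And>s. 0 \<le> s \<Longrightarrow> v s \<in> L2"
    using v unfolding classical_solution_def normalized_kernel_def by blast
  have "(L2_norm (v t))\<^sup>2 \<le> exp (2 * C * t) * ((L2_norm (v 0))\<^sup>2 + 0 * t)"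
  proof (rule energy_estimate[where v' = v', OF t])
    fix s :: real assume s: "0 \<le> s"
    have "AE x in unit_leb. (0::real) \<le> 0 \<and> \<bar>v' s x + v s x\<bar> \<le> C * L2_norm (v s) + sqrt 0"
      using v'(3)[OF s] AE_space
      by eventually_elim (use bounded_kernel_integral_le[OF K vL2[OF s]] in simp)
    from L2_inner_le_of_pointwise_bound[OF vL2[OF s] v'(1)[OF s] C _ this]
    show "2 * L2_inner (v' s) (v s) \<le> 2 * C * (L2_norm (v s))\<^sup>2 + 0"
      by simp
  qed (use C v' vL2 in auto)
  then show ?thesis by simp
qed

text \<open>
  The energy estimate for the difference \<open>e\<close> of the two solutions, which satisfies
  \<open>e' = K' e - e + (K' - K) v\<close>. The function \<open>D\<close> dominates the squared norms of the sections of
  \<open>K' - K\<close>; its integral takes the place of the squared Hilbert-Schmidt distance.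
\<close>

proposition classical_solution_stability:
  assumes K: "bounded_kernel C (normalized_kernel W)" and K': "bounded_kernel C (normalized_kernel W')"
    and v: "classical_solution W g v" and u: "classical_solution W' g' u"
    and D: "integrable unit_leb D"
    and DK: "AE x in unit_leb. (LINT y|unit_leb. (normalized_kernel W' x y - normalized_kernel W x y)\<^sup>2) \<le> D x"
    and t: "0 \<le> t"
  shows "(L2_norm (\<lambda>x. u t x - v t x))\<^sup>2 \<le> exp (2 * C * t) *
    ((L2_norm (\<lambda>x. u 0 x - v 0 x))\<^sup>2 + (LINT x|unit_leb. D x) * (exp (2 * C * t) * (L2_norm (v 0))\<^sup>2) * t)"
proof -
  have C: "0 \<le> C"
    using K by (force simp: bounded_kernel_def)
  obtain v' where v': "\<And>s. 0 \<le> s \<Longrightarrow> v' s \<in> L2" "\<And>s. 0 \<le> s \<Longrightarrow> has_L2_derivative_within v (v' s) s {0..}"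
    "\<And>s. 0 \<le> s \<Longrightarrow> AE x in unit_leb. v' s x = (LINT y|unit_leb. normalized_kernel W x y * v s y) - v s x"
    and vL2: "\<And>s. 0 \<le> s \<Longrightarrow> v s \<in> L2"
    using v unfolding classical_solution_def normalized_kernel_def by blast
  obtain u' where u': "\<And>s. 0 \<le> s \<Longrightarrow> u' s \<in> L2" "\<And>s. 0 \<le> s \<Longrightarrow> has_L2_derivative_within u (u' s) s {0..}"
    "\<And>s. 0 \<le> s \<Longrightarrow> AE x in unit_leb. u' s x = (LINT y|unit_leb. normalized_kernel W' x y * u s y) - u s x"
    and uL2: "\<And>s. 0 \<le> s \<Longrightarrow> u s \<in> L2"
    using u unfolding classical_solution_def normalized_kernel_def by blast
  have D0: "AE x in unit_leb. 0 \<le> D x"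
    using DK by eventually_elim (auto intro: order_trans[rotated] integral_nonneg_AE)
  then have ID: "0 \<le> (LINT x|unit_leb. D x)"
    by (rule integral_nonneg_AE)
  define b where "b = (LINT x|unit_leb. D x) * (exp (2 * C * t) * (L2_norm (v 0))\<^sup>2)"
  have b: "0 \<le> b"
    using ID by (simp add: b_def)
  have "(L2_norm (\<lambda>x. u t x - v t x))\<^sup>2 \<le> exp (2 * C * t) * ((L2_norm (\<lambda>x. u 0 x - v 0 x))\<^sup>2 + b * t)"
  proof (rule energy_estimate[where v = "\<lambda>s x. u s x - v s x" and v' = "\<lambda>s x. u' s x - v' s x", OF t])
    show "has_L2_derivative_within (\<lambda>s x. u s x - v s x) (\<lambda>x. u' s x - v' s x) s {0..}" if "0 \<le> s" for s
      using that u' v' uL2 vL2 by (intro has_L2_derivative_diff) auto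
  next
    fix s :: real assume s: "0 \<le> s" "s \<le> t"
    define e where "e x = u s x - v s x" for x
    define e' where "e' x = u' s x - v' s x" for x
    have e: "e \<in> L2" "e' \<in> L2"
      unfolding e_def[abs_def] e'_def[abs_def] using s u' v' uL2 vL2 by (auto intro: L2_diff)
    have "AE x in unit_leb. 0 \<le> D x * (L2_norm (v s))\<^sup>2 \<and>
        \<bar>e' x + e x\<bar> \<le> C * L2_norm e + sqrt (D x * (L2_norm (v s))\<^sup>2)"
      using v'(3)[OF s(1)] u'(3)[OF s(1)] DK D0 AE_space
    proof eventually_elim
      case (elim x)
      then have "x \<in> {0..1}" by simp
      from kernel_difference_bound[OF K K' vL2[OF s(1)] uL2[OF s(1)] this elim(3)]
      show ?case
        using elim by (simp add: e_def[abs_def] e'_def)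
    qed
    then have "2 * L2_inner e' e \<le> 2 * C * (L2_norm e)\<^sup>2 + (LINT x|unit_leb. D x * (L2_norm (v s))\<^sup>2)"
      using D by (intro L2_inner_le_of_pointwise_bound e C) auto
    also have "(LINT x|unit_leb. D x * (L2_norm (v s))\<^sup>2) = (LINT x|unit_leb. D x) * (L2_norm (v s))\<^sup>2"
      by simp
    also have "\<dots> \<le> b"
    proof -
      have "(L2_norm (v s))\<^sup>2 \<le> exp (2 * C * s) * (L2_norm (v 0))\<^sup>2"
        by (rule classical_solution_growth[OF K v s(1)])
      also have "\<dots> \<le> exp (2 * C * t) * (L2_norm (v 0))\<^sup>2"
        using C s by (intro mult_right_mono) (auto intro: mult_left_mono)
      finally show ?thesis
        unfolding b_def using ID by (rule mult_left_mono)
    qed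
    finally show "2 * L2_inner (\<lambda>x. u' s x - v' s x) (\<lambda>x. u s x - v s x)
        \<le> 2 * C * (L2_norm (\<lambda>x. u s x - v s x))\<^sup>2 + b"
      by (simp add: e_def[abs_def] e'_def[abs_def])
  qed (use C b u' v' uL2 vL2 in \<open>auto intro: L2_diff\<close>)
  then show ?thesis
    by (simp add: b_def)
qed

section \<open>The uniform partition of the interval and of the square\<close>

lemma part_bounds:
  assumes "1 \<le> n" "i \<in> {1..n}" "x \<in> part n i"
  shows "(real i - 1) / real n \<le> x" "x \<le> real i / real n" "i < n \<Longrightarrow> x < real i / real n"
  using assms by (auto simp: part_def split: if_splits)

lemma part_borel: "part n i \<in> sets borel"
  by (simp add: part_def)

lemma measure_part:
  assumes "1 \<le> n" "i \<in> {1..n}"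
  shows "measure lborel (part n i) = 1 / real n" "emeasure lborel (part n i) = ennreal (1 / real n)"
proof -
  have "(real i - 1) / real n \<le> real i / real n" "real i / real n - (real i - 1) / real n = 1 / real n"
    by (auto simp: divide_right_mono diff_divide_distrib)
  moreover have "i < n \<or> real i / real n = 1"
    using assms by auto
  ultimately show "measure lborel (part n i) = 1 / real n" "emeasure lborel (part n i) = ennreal (1 / real n)"
    unfolding part_def by auto
qed

text \<open>
  A point below \<open>(n - 1)/n\<close> lies in the half-open cell with index \<open>\<lfloor>n x\<rfloor> + 1\<close>; all others lie in
  the last cell, which is closed. Consecutive closed cells would meet in their common endpoint.
\<close>

lemma part_partition:
  assumes n: "1 \<le> n" and d: "1 / real n < d"
  shows "lebesgue_partition {0..1} d {1..n} (part n)"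
proof -
  have np: "0 < real n" using n by simp
  have disj: "part n i \<inter> part n j = {}" if "i \<in> {1..n}" "j \<in> {1..n}" "i < j" for i j
  proof -
    have "real i / real n \<le> (real j - 1) / real n"
      using that np by (intro divide_right_mono) auto
    moreover have "i < n" using that by auto
    ultimately show ?thesis
      using part_bounds[OF n that(1)] part_bounds[OF n that(2)] by fastforce
  qed
  have "disjoint_family_on (part n) {1..n}"
    unfolding disjoint_family_on_def
  proof (intro ballI impI)
    fix i j assume "i \<in> {1..n}" "j \<in> {1..n}" "i \<noteq> j"
    then show "part n i \<inter> part n j = {}"
      using disj[of i j] disj[of j i] by (cases i j rule: linorder_cases) auto
  qed
  moreover have "(\<Union>i\<in>{1..n}. part n i) = {0..1}"
  proof (intro equalityI subsetI)
    fix x assume "x \<in> (\<Union>i\<in>{1..n}. part n i)"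
    then obtain i where i: "i \<in> {1..n}" "x \<in> part n i" by blast
    have "0 \<le> (real i - 1) / real n" "real i / real n \<le> 1"
      using i np by auto
    then show "x \<in> {0..1}"
      using part_bounds[OF n i] by auto
  next
    fix x :: real assume x: "x \<in> {0..1}"
    show "x \<in> (\<Union>i\<in>{1..n}. part n i)"
    proof (cases "x < (real n - 1) / real n")
      case True
      define k where "k = nat \<lfloor>x * real n\<rfloor>"
      have "0 \<le> x * real n" using x by simp
      then have k: "real k \<le> x * real n" "x * real n < real k + 1"
        unfolding k_def by linarith+
      have "x * real n < real n - 1"
        using True np by (simp add: field_simps)
      then have "k + 1 < n"
        using k by linarith
      moreover have "x \<in> part n (k + 1)"
        using calculation k np by (simp add: part_def field_simps)
      ultimately show ?thesis
        by (intro UN_I[of "k + 1"]) auto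
    next
      case False
      then have "x \<in> part n n"
        using x by (simp add: part_def)
      then show ?thesis
        using n by (intro UN_I[of n]) auto
    qed
  qed
  moreover have "dist x y < d" if "i \<in> {1..n}" "x \<in> part n i" "y \<in> part n i" for i x y
  proof -
    have "real i / real n - (real i - 1) / real n = 1 / real n"
      by (simp add: diff_divide_distrib)
    then have "\<bar>x - y\<bar> \<le> 1 / real n"
      using part_bounds[OF n that(1,2)] part_bounds[OF n that(1,3)] by linarith
    then show ?thesis
      using d by (simp add: dist_real_def)
  qed
  ultimately show ?thesis
    unfolding lebesgue_partition_def using part_borel by auto
qed

abbreviation "unit_square \<equiv> {0..1::real} \<times> {0..1::real}"
abbreviation "square_part n \<equiv> \<lambda>(i, j). part n i \<times> part n j"

lemma square_part_partition:
  assumes n: "1 \<le> n" and d: "2 / real n < d"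
  shows "lebesgue_partition unit_square d ({1..n} \<times> {1..n}) (square_part n)"
proof -
  define \<delta> where "\<delta> = d / 2"
  have "1 / real n < \<delta>"
    using d by (simp add: \<delta>_def)
  then have P: "lebesgue_partition {0..1} \<delta> {1..n} (part n)"
    by (rule part_partition[OF n])
  have "dist (x, y) (x', y') < d"
    if "i \<in> {1..n}" "j \<in> {1..n}" "x \<in> part n i" "x' \<in> part n i" "y \<in> part n j" "y' \<in> part n j" for i j x x' y y'
  proof -
    have "dist (x, y) (x', y') \<le> dist x x' + dist y y'"
      unfolding dist_Pair_Pair by (rule sqrt_sum_squares_le_sum) auto
    moreover have "dist x x' < \<delta>" "dist y y' < \<delta>"
      using P that by (auto simp: lebesgue_partition_def)
    ultimately show ?thesis
      by (simp add: \<delta>_def)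
  qed
  moreover have "part n i \<times> part n j \<in> sets lebesgue" for i j
    using borel_Times[OF part_borel[of n i] part_borel[of n j]] by simp
  moreover have "disjoint_family_on (square_part n) ({1..n} \<times> {1..n})"
    unfolding disjoint_family_on_def
  proof (intro ballI impI)
    fix p q assume "p \<in> {1..n} \<times> {1..n}" "q \<in> {1..n} \<times> {1..n}" "p \<noteq> q"
    then obtain i j k l where pq: "p = (i, j)" "q = (k, l)" "i \<in> {1..n}" "j \<in> {1..n}" "k \<in> {1..n}" "l \<in> {1..n}"
      "i \<noteq> k \<or> j \<noteq> l"
      by (cases p, cases q) auto
    have "disjoint_family_on (part n) {1..n}"
      using P by (simp only: lebesgue_partition_def)
    then have "i \<noteq> k \<Longrightarrow> part n i \<inter> part n k = {}" "j \<noteq> l \<Longrightarrow> part n j \<inter> part n l = {}"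
      using disjoint_family_onD[OF _ pq(3,5)] disjoint_family_onD[OF _ pq(4,6)] by blast+
    then have "part n i \<inter> part n k = {} \<or> part n j \<inter> part n l = {}"
      using pq(7) by blast
    then show "square_part n p \<inter> square_part n q = {}"
      unfolding pq(1,2) prod.case Times_Int_Times by blast
  qed
  moreover have "(\<Union>p\<in>{1..n} \<times> {1..n}. square_part n p) = unit_square"
  proof -
    have "(\<Union>p\<in>{1..n} \<times> {1..n}. square_part n p) = (\<Union>i\<in>{1..n}. part n i) \<times> (\<Union>j\<in>{1..n}. part n j)"
      by (rule UN_Times_distrib)
    then show ?thesis
      using P by (simp only: lebesgue_partition_def)
  qed
  ultimately show ?thesis
    unfolding lebesgue_partition_def by (auto simp del: UN_simps)
qed

lemma measure_square_part:
  assumes "1 \<le> n" "i \<in> {1..n}" "j \<in> {1..n}"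
  shows "measure lebesgue (part n i \<times> part n j) = (1 / real n) * (1 / real n)"
proof -
  have "emeasure lborel (part n i \<times> part n j) = ennreal (1 / real n) * ennreal (1 / real n)"
    using lborel.emeasure_pair_measure_Times[of "part n i" lborel "part n j"] part_borel assms
    by (simp add: lborel_prod measure_part)
  then have "measure lborel (part n i \<times> part n j) = (1 / real n) * (1 / real n)"
    by (simp add: measure_def enn2real_mult del: times_divide_eq_left times_divide_eq_right)
  then show ?thesis
    using borel_Times[OF part_borel[of n i] part_borel[of n j]] by (simp add: measure_completion)
qed

lemma measure_lebesgue_part:
  assumes "1 \<le> n" "i \<in> {1..n}"
  shows "measure lebesgue (part n i) = 1 / real n"
  using measure_part(1)[OF assms] part_borel[of n i] by (simp add: measure_completion)

lemma averaged_eq_cell_average: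
  assumes "1 \<le> n"
  shows "averaged n g = cell_average {1..n} (part n) g"
proof
  fix x
  show "averaged n g x = cell_average {1..n} (part n) g x"
    unfolding averaged_def cell_average_def sum_distrib_left
    by (rule sum.cong[OF refl]) (simp add: measure_lebesgue_part[OF assms])
qed

text \<open>
  The factor \<open>n\<^sup>2\<close> in the edge weights is the reciprocal of the area of a cell, and the iterated
  integral over a cell is an integral over the square cell by Fubini's theorem.
\<close>

lemma step_graphon_eq_cell_average:
  assumes n: "1 \<le> n" and W: "integrable (lebesgue_on unit_square) (\<lambda>(x, y). W x y)"
  shows "step_graphon n (quotient_graph n W) x y =
    cell_average ({1..n} \<times> {1..n}) (square_part n) (\<lambda>(x, y). W x y) (x, y)"
proof -
  have P: "lebesgue_partition unit_square (2 / real n + 1) ({1..n} \<times> {1..n}) (square_part n)"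
    by (rule square_part_partition[OF n]) simp
  have A: "quotient_graph n W i j =
      (LINT z|lebesgue_on (part n i \<times> part n j). (case z of (x, y) \<Rightarrow> W x y)) / measure lebesgue (part n i \<times> part n j)"
    if "i \<in> {1..n}" "j \<in> {1..n}" for i j
  proof -
    have "integrable (lebesgue_on (part n i \<times> part n j)) (\<lambda>(x, y). W x y)"
      using integrable_on_cell[OF P _ W, of "(i, j)"] that by simp
    from lebesgue_Fubini(3)[OF part_borel part_borel this]
    show ?thesis
      using n by (simp add: quotient_graph_def measure_square_part[OF n that] power2_eq_square)
  qed
  show ?thesis
    unfolding step_graphon_def cell_average_def sum.cartesian_product
  proof (rule sum.cong[OF refl])
    fix p assume "p \<in> {1..n} \<times> {1..n}"
    then obtain i j where p: "p = (i, j)" "i \<in> {1..n}" "j \<in> {1..n}" by blast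
    show "(case p of (i, j) \<Rightarrow> quotient_graph n W i j * indicator (part n i) x * indicator (part n j) y) =
        (LINT z|lebesgue_on (square_part n p). (case z of (x, y) \<Rightarrow> W x y)) / measure lebesgue (square_part n p)
        * indicator (square_part n p) (x, y)"
      unfolding p(1) prod.case A[OF p(2,3)] indicator_times fst_conv snd_conv by (rule mult.assoc)
  qed
qed

lemma cell_average_bounds:
  assumes P: "lebesgue_partition A d I P" and i: "i \<in> I" and x: "x \<in> P i"
    and pos: "0 < measure lebesgue (P i)" and fin: "A \<in> lmeasurable"
    and f: "integrable (lebesgue_on A) f" and bd: "\<And>y. y \<in> A \<Longrightarrow> a \<le> f y \<and> f y \<le> b"
  shows "a \<le> cell_average I P f x" "cell_average I P f x \<le> b"
proof -
  note s = lebesgue_partition_sets[OF P]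
  have "P i \<in> lmeasurable"
    by (rule fmeasurableI2[OF fin s(3)[OF i] s(2)[OF i]])
  then interpret finite_measure "lebesgue_on (P i)"
    by (rule finite_measure_lebesgue_on)
  have m: "measure (lebesgue_on (P i)) (P i) = measure lebesgue (P i)"
    using s i by (simp add: measure_restrict_space)
  have fi: "integrable (lebesgue_on (P i)) f"
    by (rule integrable_on_cell[OF P i f])
  have "(LINT y|lebesgue_on (P i). a) \<le> (LINT y|lebesgue_on (P i). f y)"
    using fi bd s(3)[OF i] by (intro integral_mono) auto
  moreover have "(LINT y|lebesgue_on (P i). f y) \<le> (LINT y|lebesgue_on (P i). b)"
    using fi bd s(3)[OF i] by (intro integral_mono) auto
  ultimately show "a \<le> cell_average I P f x" "cell_average I P f x \<le> b"
    using pos by (simp_all add: cell_average_eq[OF P i x] m field_simps)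
qed

lemma averaged_tendsto:
  assumes f: "f \<in> L2"
  shows "(\<lambda>n. LINT x|unit_leb. (f x - cell_average {1..n} (part n) f x)\<^sup>2) \<longlonglongrightarrow> 0"
proof (rule order_tendstoI)
  fix e :: real assume e: "0 < e"
  have f': "f \<in> borel_measurable unit_leb" "integrable unit_leb (\<lambda>x. (f x)\<^sup>2)"
    using f by (simp_all add: L2_def)
  from cell_averages_converge[OF compact_Icc f' e, where 'i = nat]
  obtain d where d: "0 < d" "\<And>I :: nat set. \<And>P. lebesgue_partition {0..1} d I P \<Longrightarrow>
      (LINT x|unit_leb. (f x - cell_average I P f x)\<^sup>2) < e"
    by blast
  have "\<forall>\<^sub>F n in sequentially. 1 / real n < d"
    by (rule order_tendstoD(2)[OF lim_1_over_n d(1)])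
  with eventually_ge_at_top[of 1]
  show "\<forall>\<^sub>F n in sequentially. (LINT x|unit_leb. (f x - cell_average {1..n} (part n) f x)\<^sup>2) < e"
    by eventually_elim (intro d(2) part_partition)
next
  fix a :: real assume "a < 0"
  then show "\<forall>\<^sub>F n in sequentially. a < (LINT x|unit_leb. (f x - cell_average {1..n} (part n) f x)\<^sup>2)"
    by (intro always_eventually allI) (erule less_le_trans, simp)
qed

lemma square_averages_tendsto:
  assumes f: "f \<in> borel_measurable (lebesgue_on unit_square)"
    "integrable (lebesgue_on unit_square) (\<lambda>z. (f z)\<^sup>2)"
  shows "(\<lambda>n. LINT z|lebesgue_on unit_square. (f z - cell_average ({1..n} \<times> {1..n}) (square_part n) f z)\<^sup>2) \<longlonglongrightarrow> 0"
proof (rule order_tendstoI)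
  fix e :: real assume e: "0 < e"
  from cell_averages_converge[OF compact_Times[OF compact_Icc compact_Icc] f e, where 'i = "nat \<times> nat"]
  obtain d where d: "0 < d" "\<And>I :: (nat \<times> nat) set. \<And>P. lebesgue_partition unit_square d I P \<Longrightarrow>
      (LINT z|lebesgue_on unit_square. (f z - cell_average I P f z)\<^sup>2) < e"
    by blast
  have "(\<lambda>n. 2 * (1 / real n)) \<longlonglongrightarrow> 2 * 0"
    by (intro tendsto_intros lim_1_over_n)
  then have "(\<lambda>n. 2 / real n) \<longlonglongrightarrow> 0"
    by simp
  then have "\<forall>\<^sub>F n in sequentially. 2 / real n < d"
    using d(1) by (rule order_tendstoD(2))
  with eventually_ge_at_top[of 1]
  show "\<forall>\<^sub>F n in sequentially.
      (LINT z|lebesgue_on unit_square. (f z - cell_average ({1..n} \<times> {1..n}) (square_part n) f z)\<^sup>2) < e"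
    by eventually_elim (intro d(2) square_part_partition)
next
  fix a :: real assume "a < 0"
  then show "\<forall>\<^sub>F n in sequentially.
      a < (LINT z|lebesgue_on unit_square. (f z - cell_average ({1..n} \<times> {1..n}) (square_part n) f z)\<^sup>2)"
    by (intro always_eventually allI) (erule less_le_trans, simp)
qed

section \<open>Quotients of a graphon with degrees bounded below\<close>

locale graphon_positive_degree =
  fixes W :: "real \<Rightarrow> real \<Rightarrow> real" and c :: real
  assumes graphon: "graphon W" and c_pos: "0 < c"
    and degree_ge: "x \<in> {0..1} \<Longrightarrow> c \<le> graphon_degree W x"
begin

abbreviation "W2 \<equiv> (\<lambda>(x, y). W x y)"
abbreviation "Wn n \<equiv> step_graphon n (quotient_graph n W)"
abbreviation "k \<equiv> graphon_degree W"

lemma W_bounds: "x \<in> {0..1} \<Longrightarrow> y \<in> {0..1} \<Longrightarrow> 0 \<le> W x y \<and> W x y \<le> 1"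
  using graphon by (simp add: graphon_def)

lemma W2_measurable: "W2 \<in> borel_measurable (lebesgue_on unit_square)"
  using graphon by (simp add: graphon_def)

lemma unit_square_lmeasurable: "unit_square \<in> lmeasurable"
  by (rule lmeasurable_compact[OF compact_Times[OF compact_Icc compact_Icc]])

lemma W2_integrable: "integrable (lebesgue_on unit_square) W2"
proof -
  interpret finite_measure "lebesgue_on unit_square"
    using unit_square_lmeasurable by (rule finite_measure_lebesgue_on)
  show ?thesis
    by (rule integrable_const_bound[OF _ W2_measurable, of 1]) (use W_bounds in \<open>auto intro!: AE_I2\<close>)
qed

text \<open>
  Joint measurability gives this for almost every \<open>x\<close> only. It holds for every \<open>x\<close> because the
  integral of a function that is not integrable is 0 by convention, whereas the degree is positive.
\<close>

lemma W_section_integrable: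
  assumes "x \<in> {0..1}" shows "integrable unit_leb (W x)"
  using degree_ge[OF assms] c_pos not_integrable_integral_eq[of unit_leb "W x"]
  by (force simp: graphon_degree_def)

lemma degree_measurable: "k \<in> borel_measurable unit_leb"
  using borel_measurable_integrable[OF lebesgue_Fubini(2)[OF _ _ W2_integrable]]
  by (simp add: graphon_degree_def[abs_def])

lemma degree_le_1:
  assumes "x \<in> {0..1}" shows "k x \<le> 1"
proof -
  have "k x \<le> (LINT y|unit_leb. 1)"
    unfolding graphon_degree_def using W_section_integrable[OF assms] W_bounds[OF assms] finite_unit_leb
    by (intro integral_mono) (auto simp: finite_measure.integrable_const)
  then show ?thesis by simp
qed

lemma degree_L2: "k \<in> L2"
  by (rule bounded_function_in_L2[OF degree_measurable, of 1])
    (use degree_ge degree_le_1 c_pos in force)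

lemma normalized_kernel_bounded: "bounded_kernel (1 / c) (normalized_kernel W)"
  unfolding bounded_kernel_def
proof (intro ballI conjI)
  fix x :: real assume x: "x \<in> {0..1}"
  show "normalized_kernel W x \<in> borel_measurable unit_leb"
    unfolding normalized_kernel_def[abs_def]
    using W_section_integrable[OF x] degree_measurable by (intro borel_measurable_divide) auto
  fix y :: real assume y: "y \<in> {0..1}"
  show "\<bar>normalized_kernel W x y\<bar> \<le> 1 / c"
    using W_bounds[OF x y] degree_ge[OF y] c_pos
    by (auto simp: normalized_kernel_def abs_mult abs_divide intro!: frac_le)
qed

lemma Wn_eq:
  assumes "1 \<le> n"
  shows "Wn n x y = cell_average ({1..n} \<times> {1..n}) (square_part n) W2 (x, y)"
  by (rule step_graphon_eq_cell_average[OF assms W2_integrable])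

lemma Wn_bounds:
  assumes n: "1 \<le> n" and xy: "x \<in> {0..1}" "y \<in> {0..1}"
  shows "0 \<le> Wn n x y" "Wn n x y \<le> 1"
proof -
  have P: "lebesgue_partition unit_square (2 / real n + 1) ({1..n} \<times> {1..n}) (square_part n)"
    by (rule square_part_partition[OF n]) simp
  have "(x, y) \<in> unit_square"
    using xy by simp
  from lebesgue_partition_cell[OF P this]
  obtain p where p: "p \<in> {1..n} \<times> {1..n}" "(x, y) \<in> square_part n p"
    by blast
  have "0 < measure lebesgue (square_part n p)"
    using p(1) n measure_square_part[OF n] by auto
  note b = cell_average_bounds[OF P p this unit_square_lmeasurable W2_integrable, of 0 1]
  show "0 \<le> Wn n x y" "Wn n x y \<le> 1"
    unfolding Wn_eq[OF n] using b W_bounds by auto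
qed

text \<open>
  Integrating \<open>W\<^sub>n(x, y)\<close> over \<open>y\<close>, for \<open>x\<close> in \<open>P\<^sub>i\<close>, adds up the integrals of \<open>W\<close> over the strips
  \<open>P\<^sub>i \<times> P\<^sub>j\<close> and divides by the length of \<open>P\<^sub>i\<close>, which gives the mean of \<open>k\<close> over \<open>P\<^sub>i\<close>.
\<close>

lemma degree_Wn:
  assumes n: "1 \<le> n" and x: "x \<in> {0..1}"
  shows "graphon_degree (Wn n) x = cell_average {1..n} (part n) k x"
proof -
  have P: "lebesgue_partition {0..1} (1 / real n + 1) {1..n} (part n)"
    by (rule part_partition[OF n]) simp
  have P2: "lebesgue_partition unit_square (2 / real n + 1) ({1..n} \<times> {1..n}) (square_part n)"
    by (rule square_part_partition[OF n]) simp
  obtain i where i: "i \<in> {1..n}" "x \<in> part n i"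
    using lebesgue_partition_cell[OF P x] by blast
  let ?A = "quotient_graph n W"
  have Wn: "Wn n x y = (\<Sum>j\<in>{1..n}. ?A i j * indicator (part n j) y)" for y
  proof -
    have "Wn n x y = (\<Sum>i\<in>{1..n}. (\<Sum>j\<in>{1..n}. ?A i j * indicator (part n j) y) * indicator (part n i) x)"
      unfolding step_graphon_def sum_distrib_right by (intro sum.cong refl) (simp add: mult.assoc mult.left_commute)
    also have "\<dots> = (\<Sum>j\<in>{1..n}. ?A i j * indicator (part n j) y)"
      by (rule sum_cells) (use P i in \<open>simp_all add: lebesgue_partition_def\<close>)
    finally show ?thesis .
  qed
  have ind: "integrable unit_leb (indicator (part n j) :: real \<Rightarrow> real)"
    "(LINT y|unit_leb. indicator (part n j) y) = 1 / real n" if j: "j \<in> {1..n}" for j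
  proof -
    have s: "part n j \<in> sets unit_leb" "part n j \<subseteq> {0..1}"
      using lebesgue_partition_sets[OF P] j by (auto simp: sets_restrict_space_iff)
    have m: "measure unit_leb (part n j) = 1 / real n"
      using s measure_lebesgue_part[OF n j] by (simp add: measure_restrict_space)
    show "(LINT y|unit_leb. indicator (part n j) y) = 1 / real n"
      using s m by (simp add: Int_absorb2)
    show "integrable unit_leb (indicator (part n j) :: real \<Rightarrow> real)"
      using s finite_measure.emeasure_finite[OF finite_unit_leb]
      by (intro integrable_real_indicator) (auto simp: less_top[symmetric])
  qed
  have W_ij: "integrable (lebesgue_on (part n i)) (\<lambda>x. LINT y|lebesgue_on (part n j). W x y)"
    if j: "j \<in> {1..n}" for j
  proof -
    have "integrable (lebesgue_on (part n i \<times> part n j)) W2"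
      using integrable_on_cell[OF P2 _ W2_integrable, of "(i, j)"] i j by simp
    from lebesgue_Fubini(2)[OF part_borel part_borel this] show ?thesis by simp
  qed
  have "graphon_degree (Wn n) x = (\<Sum>j\<in>{1..n}. LINT y|unit_leb. ?A i j * indicator (part n j) y)"
    unfolding graphon_degree_def Wn by (intro Bochner_Integration.integral_sum integrable_mult_right ind)
  also have "\<dots> = (\<Sum>j\<in>{1..n}. real n * (LINT x|lebesgue_on (part n i). LINT y|lebesgue_on (part n j). W x y))"
  proof (rule sum.cong[OF refl])
    fix j assume "j \<in> {1..n}"
    then have "(LINT y|unit_leb. ?A i j * indicator (part n j) y) = ?A i j * (1 / real n)"
      using ind(2) by (simp only: integral_mult_right_zero)
    then show "(LINT y|unit_leb. ?A i j * indicator (part n j) y) =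
        real n * (LINT x|lebesgue_on (part n i). LINT y|lebesgue_on (part n j). W x y)"
      using n by (simp add: quotient_graph_def power2_eq_square)
  qed
  also have "\<dots> = real n * (\<Sum>j\<in>{1..n}. LINT x|lebesgue_on (part n i). LINT y|lebesgue_on (part n j). W x y)"
    by (rule sum_distrib_left[symmetric])
  also have "(\<Sum>j\<in>{1..n}. LINT x|lebesgue_on (part n i). LINT y|lebesgue_on (part n j). W x y) =
      (LINT x|lebesgue_on (part n i). (\<Sum>j\<in>{1..n}. LINT y|lebesgue_on (part n j). W x y))"
    by (rule Bochner_Integration.integral_sum[symmetric]) (rule W_ij)
  also have "\<dots> = (LINT x|lebesgue_on (part n i). k x)"
  proof (rule Bochner_Integration.integral_cong[OF refl])
    fix x assume "x \<in> space (lebesgue_on (part n i))"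
    then have "x \<in> {0..1}"
      using lebesgue_partition_sets(3)[OF P i(1)] by auto
    from integral_partition[OF P W_section_integrable[OF this]]
    show "(\<Sum>j\<in>{1..n}. LINT y|lebesgue_on (part n j). W x y) = k x"
      by (simp add: graphon_degree_def)
  qed
  finally show ?thesis
    unfolding cell_average_eq[OF P i] measure_lebesgue_part[OF n i(1)] by simp
qed

lemma degree_Wn_bounds:
  assumes n: "1 \<le> n" and x: "x \<in> {0..1}"
  shows "c \<le> graphon_degree (Wn n) x" "graphon_degree (Wn n) x \<le> 1"
proof -
  have P: "lebesgue_partition {0..1} (1 / real n + 1) {1..n} (part n)"
    by (rule part_partition[OF n]) simp
  obtain i where i: "i \<in> {1..n}" "x \<in> part n i"
    using lebesgue_partition_cell[OF P x] by blast
  have "0 < measure lebesgue (part n i)"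
    using measure_lebesgue_part[OF n i(1)] n by simp
  note bounds = cell_average_bounds[OF P i this _ L2_integrable[OF degree_L2], of c 1]
  show "c \<le> graphon_degree (Wn n) x" "graphon_degree (Wn n) x \<le> 1"
    unfolding degree_Wn[OF n x] using bounds degree_ge degree_le_1 by auto
qed

lemma degree_Wn_measurable:
  assumes n: "1 \<le> n"
  shows "graphon_degree (Wn n) \<in> borel_measurable unit_leb"
proof -
  have P: "lebesgue_partition {0..1} (1 / real n + 1) {1..n} (part n)"
    by (rule part_partition[OF n]) simp
  show ?thesis
    using measurable_cell_average[OF P, of k] 
    by (rule measurable_cong[THEN iffD1, rotated]) (simp add: degree_Wn[OF n])
qed

lemma normalized_kernel_Wn_bounded:
  assumes n: "1 \<le> n"
  shows "bounded_kernel (1 / c) (normalized_kernel (Wn n))"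
  unfolding bounded_kernel_def
proof (intro ballI conjI)
  have P: "lebesgue_partition {0..1} (1 / real n + 1) {1..n} (part n)"
    by (rule part_partition[OF n]) simp
  have "part n j \<in> sets lebesgue" for j
    using part_borel[of n j] by simp
  then have ind: "(indicator (part n j) :: real \<Rightarrow> real) \<in> borel_measurable unit_leb" for j
    by (intro measurable_restrict_space1 borel_measurable_indicator)
  fix x :: real assume x: "x \<in> {0..1}"
  have "Wn n x \<in> borel_measurable unit_leb"
    unfolding step_graphon_def[abs_def]
    by (intro borel_measurable_sum borel_measurable_times borel_measurable_const ind)
  then show "normalized_kernel (Wn n) x \<in> borel_measurable unit_leb"
    unfolding normalized_kernel_def[abs_def]
    using degree_Wn_measurable[OF n] by (rule borel_measurable_divide)
  fix y :: real assume y: "y \<in> {0..1}"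
  show "\<bar>normalized_kernel (Wn n) x y\<bar> \<le> 1 / c"
    using Wn_bounds[OF n x y] degree_Wn_bounds(1)[OF n y] c_pos
    by (auto simp: normalized_kernel_def abs_mult abs_divide intro!: frac_le)
qed

text \<open>
  From \<open>b/q - a/p = (b - a)/q + a (p - q)/(p q)\<close>, where all denominators are bounded below.
\<close>

lemma quotient_difference_square_le:
  assumes "\<bar>a\<bar> \<le> 1" "c \<le> p" "c \<le> q"
  shows "(b / q - a / p)\<^sup>2 \<le> 2 / c\<^sup>2 * (a - b)\<^sup>2 + 2 / c^4 * (p - q)\<^sup>2"
proof -
  have pos: "0 < p" "0 < q" using assms c_pos by auto
  have "b / q - a / p = (b - a) / q + a * (p - q) / (p * q)"
    using pos by (simp add: field_simps)
  then have "(b / q - a / p)\<^sup>2 \<le> 2 * ((b - a) / q)\<^sup>2 + 2 * (a * (p - q) / (p * q))\<^sup>2"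
    using square_sum_le by simp
  also have "((b - a) / q)\<^sup>2 \<le> (a - b)\<^sup>2 / c\<^sup>2"
  proof -
    have "c\<^sup>2 \<le> q\<^sup>2"
      using assms c_pos by (intro power_mono) auto
    then show ?thesis
      unfolding power_divide power2_commute[of b a] using c_pos by (intro frac_le) auto
  qed
  also have "(a * (p - q) / (p * q))\<^sup>2 \<le> (p - q)\<^sup>2 / c^4"
  proof -
    have "c * c \<le> p * q"
      using assms c_pos by (intro mult_mono) auto
    then have "(c * c)\<^sup>2 \<le> (p * q)\<^sup>2"
      using c_pos by (intro power_mono) auto
    moreover have "(c * c)\<^sup>2 = c^4"
      by (simp add: power2_eq_square power4_eq_xxxx)
    moreover have "a\<^sup>2 * (p - q)\<^sup>2 \<le> 1 * (p - q)\<^sup>2"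
      using assms(1) by (intro mult_right_mono) (auto simp: abs_square_le_1)
    ultimately show ?thesis
      unfolding power_divide power_mult_distrib using c_pos by (intro frac_le) auto
  qed
  finally show ?thesis by simp
qed

text \<open>
  The function \<open>D\<close> is the bound that results from applying \<open>quotient_difference_square_le\<close> under
  the integral over \<open>y\<close>. Its integral involves only the \<open>L\<^sup>2\<close> errors of cell averages of \<open>W\<close> and
  \<open>k\<close>, which tend to 0.
\<close>

lemma kernel_distance:
  assumes n: "1 \<le> n"
  defines "D \<equiv> \<lambda>x. 2 / c\<^sup>2 * (LINT y|unit_leb. (W x y - Wn n x y)\<^sup>2) +
      2 / c^4 * (LINT y|unit_leb. (k y - cell_average {1..n} (part n) k y)\<^sup>2)"
  shows "integrable unit_leb D"
    and "AE x in unit_leb. (LINT y|unit_leb. (normalized_kernel (Wn n) x y - normalized_kernel W x y)\<^sup>2) \<le> D x"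
    and "(LINT x|unit_leb. D x) =
      2 / c\<^sup>2 * (LINT z|lebesgue_on unit_square. (W2 z - cell_average ({1..n} \<times> {1..n}) (square_part n) W2 z)\<^sup>2) +
      2 / c^4 * (LINT y|unit_leb. (k y - cell_average {1..n} (part n) k y)\<^sup>2)"
proof -
  interpret finite_measure "lebesgue_on unit_square"
    using unit_square_lmeasurable by (rule finite_measure_lebesgue_on)
  have P2: "lebesgue_partition unit_square (2 / real n + 1) ({1..n} \<times> {1..n}) (square_part n)"
    by (rule square_part_partition[OF n]) simp
  define F where "F z = (W2 z - cell_average ({1..n} \<times> {1..n}) (square_part n) W2 z)\<^sup>2" for z
  have F_eq: "F (x, y) = (W x y - Wn n x y)\<^sup>2" for x y
    by (simp add: F_def Wn_eq[OF n])
  have "F \<in> borel_measurable (lebesgue_on unit_square)"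
    unfolding F_def[abs_def]
    by (intro borel_measurable_power borel_measurable_diff W2_measurable measurable_cell_average[OF P2])
  moreover have "norm (F z) \<le> 1" if "z \<in> space (lebesgue_on unit_square)" for z
  proof (cases z)
    case (Pair x y)
    then have "x \<in> {0..1}" "y \<in> {0..1}"
      using that by auto
    then have "\<bar>W x y - Wn n x y\<bar> \<le> 1"
      using W_bounds[of x y] Wn_bounds[OF n, of x y] by auto
    then show ?thesis
      using Pair by (simp add: F_eq abs_square_le_1)
  qed
  ultimately have F: "integrable (lebesgue_on unit_square) F"
    by (intro integrable_const_bound[where B = 1] AE_I2)
  note Fub = lebesgue_Fubini[OF _ _ F, unfolded F_eq, simplified]
  show "integrable unit_leb D"
    unfolding D_def using Fub(2) by simp
  show "(LINT x|unit_leb. D x) =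
      2 / c\<^sup>2 * (LINT z|lebesgue_on unit_square. (W2 z - cell_average ({1..n} \<times> {1..n}) (square_part n) W2 z)\<^sup>2) +
      2 / c^4 * (LINT y|unit_leb. (k y - cell_average {1..n} (part n) k y)\<^sup>2)"
    unfolding D_def using Fub(2) Fub(3) by (simp add: F_def[abs_def])
  have kL: "(\<lambda>y. k y - graphon_degree (Wn n) y) \<in> L2"
  proof (rule bounded_function_in_L2[of _ "1"])
    show "(\<lambda>y. k y - graphon_degree (Wn n) y) \<in> borel_measurable unit_leb"
      using degree_measurable degree_Wn_measurable[OF n] by (rule borel_measurable_diff)
    fix y :: real assume y: "y \<in> {0..1}"
    show "\<bar>k y - graphon_degree (Wn n) y\<bar> \<le> 1"
      using degree_Wn_bounds[OF n y] degree_ge[OF y] degree_le_1[OF y] c_pos by auto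
  qed
  have kn: "(LINT y|unit_leb. (k y - graphon_degree (Wn n) y)\<^sup>2) =
      (LINT y|unit_leb. (k y - cell_average {1..n} (part n) k y)\<^sup>2)"
    by (intro Bochner_Integration.integral_cong) (auto simp: degree_Wn[OF n])
  show "AE x in unit_leb. (LINT y|unit_leb. (normalized_kernel (Wn n) x y - normalized_kernel W x y)\<^sup>2) \<le> D x"
    using Fub(1) AE_space
  proof eventually_elim
    case (elim x)
    then have x: "x \<in> {0..1}" by simp
    have k2: "integrable unit_leb (\<lambda>y. (k y - graphon_degree (Wn n) y)\<^sup>2)"
      using kL by (simp add: L2_def)
    have "(LINT y|unit_leb. (normalized_kernel (Wn n) x y - normalized_kernel W x y)\<^sup>2)
      \<le> (LINT y|unit_leb. 2 / c\<^sup>2 * (W x y - Wn n x y)\<^sup>2 + 2 / c^4 * (k y - graphon_degree (Wn n) y)\<^sup>2)"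
    proof (rule integral_mono)
      show "integrable unit_leb (\<lambda>y. (normalized_kernel (Wn n) x y - normalized_kernel W x y)\<^sup>2)"
        using L2_diff[OF bounded_kernel_L2[OF normalized_kernel_Wn_bounded[OF n] x]
            bounded_kernel_L2[OF normalized_kernel_bounded x]] by (simp add: L2_def)
      show "integrable unit_leb (\<lambda>y. 2 / c\<^sup>2 * (W x y - Wn n x y)\<^sup>2 + 2 / c^4 * (k y - graphon_degree (Wn n) y)\<^sup>2)"
        using elim(1) k2 by simp
      fix y assume "y \<in> space unit_leb"
      then have y: "y \<in> {0..1}" by simp
      show "(normalized_kernel (Wn n) x y - normalized_kernel W x y)\<^sup>2
          \<le> 2 / c\<^sup>2 * (W x y - Wn n x y)\<^sup>2 + 2 / c^4 * (k y - graphon_degree (Wn n) y)\<^sup>2"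
        unfolding normalized_kernel_def using W_bounds[OF x y] degree_ge[OF y] degree_Wn_bounds(1)[OF n y]
        by (intro quotient_difference_square_le) auto
    qed
    also have "\<dots> = D x"
      using elim(1) k2 by (simp add: D_def kn)
    finally show ?case .
  qed
qed

text \<open>
  All kernels are bounded by \<open>1/c\<close>, so the factor \<open>exp (2 t / c)\<close> in the stability estimate is the
  same for every \<open>n\<close>, and what it multiplies tends to 0.
\<close>

theorem quotient_solutions_converge:
  assumes g: "g \<in> L2" and w: "classical_solution W g w"
    and u: "\<And>n. 1 \<le> n \<Longrightarrow> classical_solution (Wn n) (averaged n g) (u n)" and t: "0 \<le> t"
  shows "(\<lambda>n. L2_norm (\<lambda>x. u n t x - w t x)) \<longlonglongrightarrow> 0"
proof -
  define E where "E n = (LINT x|unit_leb. (g x - cell_average {1..n} (part n) g x)\<^sup>2)" for n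
  define S where "S n = 2 / c\<^sup>2 * (LINT z|lebesgue_on unit_square.
        (W2 z - cell_average ({1..n} \<times> {1..n}) (square_part n) W2 z)\<^sup>2) +
      2 / c^4 * (LINT y|unit_leb. (k y - cell_average {1..n} (part n) k y)\<^sup>2)" for n
  define G where "G = exp (2 * (1 / c) * t)"
  define B where "B n = G * (E n + S n * (G * (L2_norm (w 0))\<^sup>2) * t)" for n
  have "integrable (lebesgue_on unit_square) (\<lambda>z. (W2 z)\<^sup>2)"
  proof -
    interpret finite_measure "lebesgue_on unit_square"
      using unit_square_lmeasurable by (rule finite_measure_lebesgue_on)
    have "(\<lambda>z. (W2 z)\<^sup>2) \<in> borel_measurable (lebesgue_on unit_square)"
      by (intro borel_measurable_power W2_measurable)
    then show ?thesis
      by (rule integrable_const_bound[rotated, of _ 1]) (use W_bounds in \<open>auto intro!: AE_I2 simp: abs_square_le_1\<close>)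
  qed
  note W2_lim = square_averages_tendsto[OF W2_measurable this]
  have S: "S \<longlonglongrightarrow> 2 / c\<^sup>2 * 0 + 2 / c^4 * 0"
    unfolding S_def by (intro tendsto_intros W2_lim averaged_tendsto degree_L2)
  have E: "E \<longlonglongrightarrow> 0"
    unfolding E_def by (rule averaged_tendsto[OF g])
  have "B \<longlonglongrightarrow> G * (0 + (2 / c\<^sup>2 * 0 + 2 / c^4 * 0) * (G * (L2_norm (w 0))\<^sup>2) * t)"
    unfolding B_def by (intro tendsto_intros S E)
  then have B: "B \<longlonglongrightarrow> 0" by simp
  have le: "(L2_norm (\<lambda>x. u n t x - w t x))\<^sup>2 \<le> B n" if n: "1 \<le> n" for n
  proof -
    note K = kernel_distance[OF n]
    have "(L2_norm (\<lambda>x. u n 0 x - w 0 x))\<^sup>2 = E n"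
    proof -
      have P: "lebesgue_partition {0..1} (1 / real n + 1) {1..n} (part n)"
        by (rule part_partition[OF n]) simp
      have L: "u n 0 \<in> L2" "w 0 \<in> L2" "AE x in unit_leb. u n 0 x = averaged n g x" "AE x in unit_leb. w 0 x = g x"
        using u[OF n] w by (auto simp: classical_solution_def)
      have m: "(\<lambda>x. (u n 0 x - w 0 x)\<^sup>2) \<in> borel_measurable unit_leb"
        using L2_diff[OF L(1,2)] by (auto simp: L2_def)
      have m': "(\<lambda>x. (g x - cell_average {1..n} (part n) g x)\<^sup>2) \<in> borel_measurable unit_leb"
        using measurable_cell_average[OF P] g
        by (intro borel_measurable_power borel_measurable_diff) (auto simp: L2_def)
      have "AE x in unit_leb. (u n 0 x - w 0 x)\<^sup>2 = (g x - cell_average {1..n} (part n) g x)\<^sup>2"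
        using L(3,4) by eventually_elim (simp add: averaged_eq_cell_average[OF n] power2_commute)
      then show ?thesis
        unfolding L2_norm_square E_def by (rule integral_cong_AE[OF m m'])
    qed
    then show ?thesis
      using classical_solution_stability[OF normalized_kernel_bounded normalized_kernel_Wn_bounded[OF n]
          w u[OF n] K(1,2) t]
      unfolding K(3) B_def S_def[symmetric] G_def by simp
  qed
  have "(\<lambda>n. (L2_norm (\<lambda>x. u n t x - w t x))\<^sup>2) \<longlonglongrightarrow> 0"
  proof (rule tendsto_sandwich[OF _ _ tendsto_const B])
    show "\<forall>\<^sub>F n in sequentially. (L2_norm (\<lambda>x. u n t x - w t x))\<^sup>2 \<le> B n"
      using eventually_ge_at_top[of 1] by eventually_elim (rule le)
  qed simp
  then have "(\<lambda>n. sqrt ((L2_norm (\<lambda>x. u n t x - w t x))\<^sup>2)) \<longlonglongrightarrow> sqrt 0"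
    by (rule tendsto_real_sqrt)
  then show ?thesis by simp
qed

end

theorem theorem5p5:
  fixes W :: "real \<Rightarrow> real \<Rightarrow> real" and g :: "real \<Rightarrow> real" and c t :: real
    and w :: "real \<Rightarrow> real \<Rightarrow> real" and u :: "nat \<Rightarrow> real \<Rightarrow> real \<Rightarrow> real"
  assumes "connected_graphon W"
    and "0 < c"
    and "\<forall>x\<in>{0..1}. c \<le> graphon_degree W x"
    and "g \<in> L2"
    and "classical_solution W g w"
    and "\<forall>n\<ge>1. classical_solution (step_graphon n (quotient_graph n W)) (averaged n g) (u n)"
    and "0 \<le> t"
  shows "(\<lambda>n. L2_norm (\<lambda>x. u n t x - w t x)) \<longlonglongrightarrow> 0"
proof -
  interpret graphon_positive_degree W c
    using assms by unfold_locales (auto simp: connected_graphon_def)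
  show ?thesis
    using assms by (intro quotient_solutions_converge) auto
qed

end
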